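(* Let $P\colon(\mathcal X,F)\to(\mathcal M,G)$ be a fiberwise opfibration in $\mathbf{Fib}(\mathcal A)$ with $G$ a split fibration, and let $\bar{\mathcal X}$, $\bar F\colon\bar{\mathcal X}\to\mathcal A$ and $Q\colon\mathcal X\to\bar{\mathcal X}$ be the category and functors constructed from $P$ as described in the context. Then the functor $Q\colon(\mathcal X,F)\to(\bar{\mathcal X},\bar F)$ is initial in $\mathbf{Fib}(\mathcal A)$.
   Context: (Op)cartesian arrows, (op)cartesian liftings and Grothendieck (op)fibrations are as usual; an arrow $f$ is $F$-vertical if $F(f)$ is an identity. All (op)fibrations are assumed to admit a cleavage. A fibration is split if it admits a functorial cleavage (chosen cartesian liftings compatible with composition and identities). $\mathbf{Fib}(\mathcal A)$ is the 2-category whose objects are fibrations $(\mathcal X,F)$, $F\colon\mathcal X\to\mathcal A$; 1-cells are functors over $\mathcal A$ preserving cartesian arrows; 2-cells are natural transformations with vertical components. $P$ is a fiberwise opfibration if for every object $a$ of $\mathcal A$ the restriction $P_a\colon\mathcal X_a\to\mathcal M_a$ to the fibers over $a$ is an opfibration. Construction. Fix a functorial cleavage of $G$. For $\alpha\colon a\to Fx$ in $\mathcal A$, an $F$-cartesian lifting $\hat\alpha^{x}\colon\alpha^*x\to x$ of $\alpha$ at $x$ is always chosen such that $P(\hat\alpha^x)$ is the chosen $G$-cartesian lifting of $\alpha$ at $Px$ (such a choice is always possible). For $\beta\colon Px\to m$ with $G\beta=1_{Fx}$, let $\hat\beta\colon x\to\beta_*x$ be an opcartesian lifting of $\beta$ at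 $x$ in the fiber over $Fx$. - Objects of $\bar{\mathcal X}$: equivalence classes $\bar x$ of objects of $\mathcal X$, where $x\sim x'$ iff there is a zig-zag of $P$-vertical arrows connecting $x$ to $x'$. - Morphisms $\mu\colon\bar x_1\to\bar x_2$: arrows $\mu\colon Px_1\to Px_2$ of $\mathcal M$ such that $\overline{\beta_*x_1}=\overline{\alpha^*x_2}$, where $\alpha=G\mu$ and $\beta$ is the unique arrow of $\mathcal M$ with $P(\hat\alpha^{x_2})\cdot\beta=\mu$ and $G\beta=1$ (this is independent of the representatives). Identities and composition are those of $\mathcal M$. - $\bar F(\mu\colon\bar x_1\to\bar x_2)=(G\mu\colon Fx_1\to Fx_2)$ (this is a fibration), and $Q(\xi\colon x_1\to x_2)=(P\xi\colon\bar x_1\to\bar x_2)$ (this is a morphism of $\mathbf{Fib}(\mathcal A)$). A 1-cell $f\colon A\to B$ of a 2-category with comma objects is initial if it is left orthogonal to every discrete opfibration: for every discrete opfibration $g\colon C\to D$ and every $h\colon A\to C$, $k\colon B\to D$ with $g\cdot h=k\cdot f$ there is a unique $d\colon B\to C$ with $d\cdot f=h$ and $g\cdot d=k$. A 1-cell $p\colon E\to B$ is a discrete opfibration if the canonical 1-cell $r\colon E\downarrow E\to p\downarrow B$ between comma objects has a left adjoint with identity unit and identity counit (so $r$ is an isomorphism). In $\mathbf{Fib}(\mathcal A)$, for $P\colon(\mathcal X,F)\to(\mathcal M,G)$: the objects of $P\downarrow(\mathcal M,G)$ are triples $(x,\beta\colon Px\to m,m)$ with $G\beta=1_{Fx}$,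 with arrows pairs forming commutative squares. The objects of $(\mathcal X,F)\downarrow(\mathcal X,F)$ are triples $(x_0,\nu\colon x_0\to x_1,x_1)$ with $F\nu=1$, with arrows the commutative squares, and $r(x_0,\nu,x_1)=(x_0,P\nu,Px_1)$. *)

theory Defs
  imports Main
begin

section \<open>Categories and functors\<close>

record ('o, 'a) cat =
  Obj :: "'o set"
  Arr :: "'a set"
  Dom :: "'a \<Rightarrow> 'o"
  Cod :: "'a \<Rightarrow> 'o"
  Ident :: "'o \<Rightarrow> 'a"
  Comp :: "'a \<Rightarrow> 'a \<Rightarrow> 'a"  (infixl "\<cdot>\<index>" 70)

definition hom :: "('o, 'a) cat \<Rightarrow> 'o \<Rightarrow> 'o \<Rightarrow> 'a set" where
  "hom C x y = {f \<in> Arr C. Dom C f = x \<and> Cod C f = y}"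

text \<open>Composition is written in applicative order: \<open>g \<cdot> f\<close> is \<open>f\<close> followed by \<open>g\<close>.\<close>

locale category =
  fixes C :: "('o, 'a) cat" (structure)
  assumes dom_obj: "f \<in> Arr C \<Longrightarrow> Dom C f \<in> Obj C"
    and cod_obj: "f \<in> Arr C \<Longrightarrow> Cod C f \<in> Obj C"
    and ident_hom: "x \<in> Obj C \<Longrightarrow> Ident C x \<in> hom C x x"
    and comp_hom: "\<lbrakk>f \<in> hom C x y; g \<in> hom C y z\<rbrakk> \<Longrightarrow> g \<cdot> f \<in> hom C x z"
    and ident_right: "f \<in> Arr C \<Longrightarrow> f \<cdot> Ident C (Dom C f) = f"
    and ident_left: "f \<in> Arr C \<Longrightarrow> Ident C (Cod C f) \<cdot> f = f"
    and comp_assoc: "\<lbrakk>f \<in> hom C w x; g \<in> hom C x y; h \<in> hom C y z\<rbrakk>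
                      \<Longrightarrow> (h \<cdot> g) \<cdot> f = h \<cdot> (g \<cdot> f)"

lemma (in category) hom_ident:
  assumes "f \<in> hom C x y"
  shows "f \<cdot> Ident C x = f" "Ident C y \<cdot> f = f"
  using ident_right[of f] ident_left[of f] assms by (auto simp: hom_def)

record ('o, 'a, 'p, 'b) func =
  OMap :: "'o \<Rightarrow> 'p"
  AMap :: "'a \<Rightarrow> 'b"

locale is_functor = dom: category C + cod: category D
  for C :: "('o, 'a) cat" and D :: "('p, 'b) cat" and F :: "('o, 'a, 'p, 'b) func" +
  assumes map_obj: "x \<in> Obj C \<Longrightarrow> OMap F x \<in> Obj D"
    and map_hom: "f \<in> hom C x y \<Longrightarrow> AMap F f \<in> hom D (OMap F x) (OMap F y)"
    and map_ident: "x \<in> Obj C \<Longrightarrow> AMap F (Ident C x) = Ident D (OMap F x)"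
    and map_comp: "\<lbrakk>f \<in> hom C x y; g \<in> hom C y z\<rbrakk>
                    \<Longrightarrow> AMap F (g \<cdot>\<^bsub>C\<^esub> f) = AMap F g \<cdot>\<^bsub>D\<^esub> AMap F f"

definition func_id :: "('o, 'a, 'o, 'a) func" where
  "func_id = \<lparr>OMap = (\<lambda>x. x), AMap = (\<lambda>f. f)\<rparr>"

definition func_comp ::
  "('p, 'b, 'q, 'c) func \<Rightarrow> ('o, 'a, 'p, 'b) func \<Rightarrow> ('o, 'a, 'q, 'c) func" (infixl "\<odot>" 70) where
  "K \<odot> H = \<lparr>OMap = (\<lambda>x. OMap K (OMap H x)), AMap = (\<lambda>f. AMap K (AMap H f))\<rparr>"

text \<open>The maps of a functor are total functions on the underlying types and their values outside
  the carriers carry no meaning; two functors on \<open>C\<close> are therefore equal when they agree on the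
  carriers of \<open>C\<close>.\<close>

definition func_eq :: "('o, 'a) cat \<Rightarrow> ('o, 'a, 'p, 'b) func \<Rightarrow> ('o, 'a, 'p, 'b) func \<Rightarrow> bool" where
  "func_eq C H K \<longleftrightarrow> (\<forall>x\<in>Obj C. OMap H x = OMap K x) \<and> (\<forall>f\<in>Arr C. AMap H f = AMap K f)"


section \<open>Fibrations and opfibrations\<close>

definition cartesian ::
  "('o, 'a) cat \<Rightarrow> ('p, 'b) cat \<Rightarrow> ('o, 'a, 'p, 'b) func \<Rightarrow> 'a \<Rightarrow> bool" where
  "cartesian X A F f \<longleftrightarrow> f \<in> Arr X \<and>
     (\<forall>g\<in>Arr X. \<forall>\<gamma>\<in>hom A (OMap F (Dom X g)) (OMap F (Dom X f)).
        Cod X g = Cod X f \<and> AMap F f \<cdot>\<^bsub>A\<^esub> \<gamma> = AMap F g \<longrightarrow>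
        (\<exists>!h. h \<in> hom X (Dom X g) (Dom X f) \<and> AMap F h = \<gamma> \<and> f \<cdot>\<^bsub>X\<^esub> h = g))"

definition opcartesian ::
  "('o, 'a) cat \<Rightarrow> ('p, 'b) cat \<Rightarrow> ('o, 'a, 'p, 'b) func \<Rightarrow> 'a \<Rightarrow> bool" where
  "opcartesian X A F f \<longleftrightarrow> f \<in> Arr X \<and>
     (\<forall>g\<in>Arr X. \<forall>\<gamma>\<in>hom A (OMap F (Cod X f)) (OMap F (Cod X g)).
        Dom X g = Dom X f \<and> \<gamma> \<cdot>\<^bsub>A\<^esub> AMap F f = AMap F g \<longrightarrow>
        (\<exists>!h. h \<in> hom X (Cod X f) (Cod X g) \<and> AMap F h = \<gamma> \<and> h \<cdot>\<^bsub>X\<^esub> f = g))"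

text \<open>A cleavage \<open>c\<close> assigns to \<open>\<alpha> : a \<rightarrow> F x\<close> a cartesian lifting \<open>c \<alpha> x : \<alpha>\<^sup>* x \<rightarrow> x\<close>, an
  opcleavage assigns to \<open>\<beta> : F x \<rightarrow> b\<close> an opcartesian lifting \<open>c \<beta> x : x \<rightarrow> \<beta>\<^sub>* x\<close>.\<close>

definition cleavage ::
  "('o, 'a) cat \<Rightarrow> ('p, 'b) cat \<Rightarrow> ('o, 'a, 'p, 'b) func \<Rightarrow> ('b \<Rightarrow> 'o \<Rightarrow> 'a) \<Rightarrow> bool" where
  "cleavage X A F c \<longleftrightarrow> (\<forall>x\<in>Obj X. \<forall>\<alpha>\<in>Arr A. Cod A \<alpha> = OMap F x \<longrightarrow>
     cartesian X A F (c \<alpha> x) \<and> Cod X (c \<alpha> x) = x \<and> AMap F (c \<alpha> x) = \<alpha>)"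

definition opcleavage ::
  "('o, 'a) cat \<Rightarrow> ('p, 'b) cat \<Rightarrow> ('o, 'a, 'p, 'b) func \<Rightarrow> ('b \<Rightarrow> 'o \<Rightarrow> 'a) \<Rightarrow> bool" where
  "opcleavage X A F c \<longleftrightarrow> (\<forall>x\<in>Obj X. \<forall>\<beta>\<in>Arr A. Dom A \<beta> = OMap F x \<longrightarrow>
     opcartesian X A F (c \<beta> x) \<and> Dom X (c \<beta> x) = x \<and> AMap F (c \<beta> x) = \<beta>)"

definition functorial_cleavage ::
  "('o, 'a) cat \<Rightarrow> ('p, 'b) cat \<Rightarrow> ('o, 'a, 'p, 'b) func \<Rightarrow> ('b \<Rightarrow> 'o \<Rightarrow> 'a) \<Rightarrow> bool" where
  "functorial_cleavage X A F c \<longleftrightarrow> cleavage X A F c \<and>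
     (\<forall>x\<in>Obj X. c (Ident A (OMap F x)) x = Ident X x) \<and>
     (\<forall>x\<in>Obj X. \<forall>\<beta>\<in>Arr A. \<forall>\<alpha>\<in>Arr A. Cod A \<beta> = OMap F x \<and> Cod A \<alpha> = Dom A \<beta> \<longrightarrow>
        c (\<beta> \<cdot>\<^bsub>A\<^esub> \<alpha>) x = c \<beta> x \<cdot>\<^bsub>X\<^esub> c \<alpha> (Dom X (c \<beta> x)))"

definition fibration :: "('o, 'a) cat \<Rightarrow> ('p, 'b) cat \<Rightarrow> ('o, 'a, 'p, 'b) func \<Rightarrow> bool" where
  "fibration X A F \<longleftrightarrow> is_functor X A F \<and> (\<exists>c. cleavage X A F c)"

definition opfibration :: "('o, 'a) cat \<Rightarrow> ('p, 'b) cat \<Rightarrow> ('o, 'a, 'p, 'b) func \<Rightarrow> bool" where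
  "opfibration X A F \<longleftrightarrow> is_functor X A F \<and> (\<exists>c. opcleavage X A F c)"

definition split_fibration :: "('o, 'a) cat \<Rightarrow> ('p, 'b) cat \<Rightarrow> ('o, 'a, 'p, 'b) func \<Rightarrow> bool" where
  "split_fibration X A F \<longleftrightarrow> is_functor X A F \<and> (\<exists>c. functorial_cleavage X A F c)"

definition vertical :: "('o, 'a) cat \<Rightarrow> ('p, 'b) cat \<Rightarrow> ('o, 'a, 'p, 'b) func \<Rightarrow> 'a \<Rightarrow> bool" where
  "vertical X A F f \<longleftrightarrow> f \<in> Arr X \<and> (\<exists>a\<in>Obj A. AMap F f = Ident A a)"

definition fiber ::
  "('o, 'a) cat \<Rightarrow> ('p, 'b) cat \<Rightarrow> ('o, 'a, 'p, 'b) func \<Rightarrow> 'p \<Rightarrow> ('o, 'a) cat" where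
  "fiber X A F a = X\<lparr>Obj := {x \<in> Obj X. OMap F x = a}, Arr := {f \<in> Arr X. AMap F f = Ident A a}\<rparr>"


section \<open>The 2-category of fibrations over a fixed base\<close>

text \<open>An object over the base category \<open>A\<close> is a pair \<open>(X, F)\<close> with \<open>F : X \<rightarrow> A\<close>.\<close>

type_synonym ('o, 'a, 'p, 'b) over = "('o, 'a) cat \<times> ('o, 'a, 'p, 'b) func"

fun fib_obj :: "('p, 'b) cat \<Rightarrow> ('o, 'a, 'p, 'b) over \<Rightarrow> bool" where
  "fib_obj A (X, F) \<longleftrightarrow> fibration X A F"

fun fib_1cell :: "('p, 'b) cat \<Rightarrow> ('xo, 'xa, 'p, 'b) over \<Rightarrow> ('mo, 'ma, 'p, 'b) over
    \<Rightarrow> ('xo, 'xa, 'mo, 'ma) func \<Rightarrow> bool" where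
  "fib_1cell A (X, F) (M, G) P \<longleftrightarrow>
     fib_obj A (X, F) \<and> fib_obj A (M, G) \<and> is_functor X M P \<and> func_eq X (G \<odot> P) F \<and>
     (\<forall>f. cartesian X A F f \<longrightarrow> cartesian M A G (AMap P f))"

fun fib_2cell :: "('p, 'b) cat \<Rightarrow> ('xo, 'xa, 'p, 'b) over \<Rightarrow> ('mo, 'ma, 'p, 'b) over
    \<Rightarrow> ('xo, 'xa, 'mo, 'ma) func \<Rightarrow> ('xo, 'xa, 'mo, 'ma) func \<Rightarrow> ('xo \<Rightarrow> 'ma) \<Rightarrow> bool" where
  "fib_2cell A (X, F) (M, G) P P' \<theta> \<longleftrightarrow>
     fib_1cell A (X, F) (M, G) P \<and> fib_1cell A (X, F) (M, G) P' \<and>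
     (\<forall>x\<in>Obj X. \<theta> x \<in> hom M (OMap P x) (OMap P' x) \<and> vertical M A G (\<theta> x)) \<and>
     (\<forall>f\<in>Arr X. \<theta> (Cod X f) \<cdot>\<^bsub>M\<^esub> AMap P f = AMap P' f \<cdot>\<^bsub>M\<^esub> \<theta> (Dom X f))"

text \<open>\<open>l : (M, G) \<rightarrow> (X, F)\<close> is left adjoint to \<open>r : (X, F) \<rightarrow> (M, G)\<close> with unit \<open>\<eta>\<close> and
  counit \<open>\<epsilon>\<close>.\<close>

fun fib_adjunction :: "('p, 'b) cat \<Rightarrow> ('xo, 'xa, 'p, 'b) over \<Rightarrow> ('mo, 'ma, 'p, 'b) over
    \<Rightarrow> ('mo, 'ma, 'xo, 'xa) func \<Rightarrow> ('xo, 'xa, 'mo, 'ma) func \<Rightarrow> ('mo \<Rightarrow> 'ma) \<Rightarrow> ('xo \<Rightarrow> 'xa)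
    \<Rightarrow> bool" where
  "fib_adjunction A (X, F) (M, G) l r \<eta> \<epsilon> \<longleftrightarrow>
     fib_1cell A (M, G) (X, F) l \<and> fib_1cell A (X, F) (M, G) r \<and>
     fib_2cell A (M, G) (M, G) func_id (r \<odot> l) \<eta> \<and>
     fib_2cell A (X, F) (X, F) (l \<odot> r) func_id \<epsilon> \<and>
     (\<forall>m\<in>Obj M. \<epsilon> (OMap l m) \<cdot>\<^bsub>X\<^esub> AMap l (\<eta> m) = Ident X (OMap l m)) \<and>
     (\<forall>x\<in>Obj X. AMap r (\<epsilon> x) \<cdot>\<^bsub>M\<^esub> \<eta> (OMap r x) = Ident M (OMap r x))"

definition fiberwise_opfibration :: "('p, 'b) cat \<Rightarrow> ('xo, 'xa) cat \<Rightarrow> ('xo, 'xa, 'p, 'b) func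
    \<Rightarrow> ('mo, 'ma) cat \<Rightarrow> ('mo, 'ma, 'p, 'b) func \<Rightarrow> ('xo, 'xa, 'mo, 'ma) func \<Rightarrow> bool" where
  "fiberwise_opfibration A X F M G P \<longleftrightarrow>
     (\<forall>a\<in>Obj A. opfibration (fiber X A F a) (fiber M A G a) P)"


section \<open>Comma objects, discrete opfibrations and initial 1-cells\<close>

text \<open>The comma object \<open>P \<down> (M, G)\<close> for \<open>P : (X, F) \<rightarrow> (M, G)\<close>. An arrow is stored together with
  its domain and codomain.\<close>

type_synonym ('xo, 'ma, 'mo) comma_obj = "'xo \<times> 'ma \<times> 'mo"
type_synonym ('xo, 'xa, 'mo, 'ma) comma_arr =
  "('xo, 'ma, 'mo) comma_obj \<times> ('xa \<times> 'ma) \<times> ('xo, 'ma, 'mo) comma_obj"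

definition comma_objs :: "('p, 'b) cat \<Rightarrow> ('xo, 'xa, 'p, 'b) over \<Rightarrow> ('mo, 'ma, 'p, 'b) over
    \<Rightarrow> ('xo, 'xa, 'mo, 'ma) func \<Rightarrow> ('xo, 'ma, 'mo) comma_obj set" where
  "comma_objs A XF MG P = (case (XF, MG) of ((X, F), (M, G)) \<Rightarrow>
     {(x, \<beta>, m). x \<in> Obj X \<and> m \<in> Obj M \<and> \<beta> \<in> hom M (OMap P x) m
                  \<and> AMap G \<beta> = Ident A (OMap F x)})"

definition comma_cat :: "('p, 'b) cat \<Rightarrow> ('xo, 'xa, 'p, 'b) over \<Rightarrow> ('mo, 'ma, 'p, 'b) over
    \<Rightarrow> ('xo, 'xa, 'mo, 'ma) func
    \<Rightarrow> (('xo, 'ma, 'mo) comma_obj, ('xo, 'xa, 'mo, 'ma) comma_arr) cat" where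
  "comma_cat A XF MG P = (case (XF, MG) of ((X, F), (M, G)) \<Rightarrow>
     \<lparr> Obj = comma_objs A XF MG P,
       Arr = {((x, \<beta>, m), (f, j), (x', \<beta>', m')) | x \<beta> m f j x' \<beta>' m'.
                (x, \<beta>, m) \<in> comma_objs A XF MG P \<and> (x', \<beta>', m') \<in> comma_objs A XF MG P \<and>
                f \<in> hom X x x' \<and> j \<in> hom M m m' \<and> \<beta>' \<cdot>\<^bsub>M\<^esub> AMap P f = j \<cdot>\<^bsub>M\<^esub> \<beta>},
       Dom = (\<lambda>(s, _, _). s),
       Cod = (\<lambda>(_, _, t). t),
       Ident = (\<lambda>(x, \<beta>, m). ((x, \<beta>, m), (Ident X x, Ident M m), (x, \<beta>, m))),
       Comp = (\<lambda>(_, (f', j'), t) (s, (f, j), _). (s, (f' \<cdot>\<^bsub>X\<^esub> f, j' \<cdot>\<^bsub>M\<^esub> j), t)) \<rparr>)"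

definition comma_proj :: "('xo, 'xa, 'p, 'b) func
    \<Rightarrow> (('xo, 'ma, 'mo) comma_obj, ('xo, 'xa, 'mo, 'ma) comma_arr, 'p, 'b) func" where
  "comma_proj F = \<lparr>OMap = (\<lambda>(x, _, _). OMap F x), AMap = (\<lambda>(_, (f, _), _). AMap F f)\<rparr>"

definition comma_over :: "('p, 'b) cat \<Rightarrow> ('xo, 'xa, 'p, 'b) over \<Rightarrow> ('mo, 'ma, 'p, 'b) over
    \<Rightarrow> ('xo, 'xa, 'mo, 'ma) func
    \<Rightarrow> (('xo, 'ma, 'mo) comma_obj, ('xo, 'xa, 'mo, 'ma) comma_arr, 'p, 'b) over" where
  "comma_over A XF MG P = (comma_cat A XF MG P, comma_proj (snd XF))"

text \<open>The canonical 1-cell \<open>r : (X, F) \<down> (X, F) \<rightarrow> P \<down> (M, G)\<close>, where \<open>(X, F) \<down> (X, F)\<close> is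
  \<open>comma_over A (X, F) (X, F) func_id\<close>.\<close>

definition comma_comparison :: "('xo, 'xa, 'mo, 'ma) func
    \<Rightarrow> (('xo, 'xa, 'xo) comma_obj, ('xo, 'xa, 'xo, 'xa) comma_arr,
        ('xo, 'ma, 'mo) comma_obj, ('xo, 'xa, 'mo, 'ma) comma_arr) func" where
  "comma_comparison P =
     (let r = (\<lambda>(x0, \<nu>, x1). (x0, AMap P \<nu>, OMap P x1))
      in \<lparr>OMap = r, AMap = (\<lambda>(s, (f0, f1), t). (r s, (f0, AMap P f1), r t))\<rparr>)"

definition discrete_opfibration :: "('p, 'b) cat \<Rightarrow> ('xo, 'xa, 'p, 'b) over
    \<Rightarrow> ('mo, 'ma, 'p, 'b) over \<Rightarrow> ('xo, 'xa, 'mo, 'ma) func \<Rightarrow> bool" where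
  "discrete_opfibration A XF MG P \<longleftrightarrow> fib_1cell A XF MG P \<and>
     (let E = comma_over A XF XF func_id; B = comma_over A XF MG P in
      \<exists>l \<eta> \<epsilon>. fib_adjunction A E B l (comma_comparison P) \<eta> \<epsilon> \<and>
        (\<forall>b\<in>Obj (fst B). \<eta> b = Ident (fst B) b) \<and>
        (\<forall>e\<in>Obj (fst E). \<epsilon> e = Ident (fst E) e))"

text \<open>Since a HOL formula cannot quantify over types, the types of the objects and arrows of the
  discrete opfibrations tested against are parameters, the last two arguments. A theorem leaving
  these type variables free speaks about all discrete opfibrations.\<close>

definition initial_1cell :: "('p, 'b) cat \<Rightarrow> ('xo, 'xa, 'p, 'b) over \<Rightarrow> ('yo, 'ya, 'p, 'b) over
    \<Rightarrow> ('xo, 'xa, 'yo, 'ya) func \<Rightarrow> ('co \<times> 'ca) itself \<Rightarrow> ('do \<times> 'da) itself \<Rightarrow> bool" where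
  "initial_1cell A XF YK f TC TD \<longleftrightarrow> fib_1cell A XF YK f \<and>
     (\<forall>(C :: ('co, 'ca, 'p, 'b) over) (D :: ('do, 'da, 'p, 'b) over) g h k.
        discrete_opfibration A C D g \<and> fib_1cell A XF C h \<and> fib_1cell A YK D k \<and>
        func_eq (fst XF) (g \<odot> h) (k \<odot> f) \<longrightarrow>
        (\<exists>d. fib_1cell A YK C d \<and> func_eq (fst XF) (d \<odot> f) h \<and> func_eq (fst YK) (g \<odot> d) k \<and>
           (\<forall>d'. fib_1cell A YK C d' \<and> func_eq (fst XF) (d' \<odot> f) h \<and> func_eq (fst YK) (g \<odot> d') k
                 \<longrightarrow> func_eq (fst YK) d' d)))"


section \<open>The category constructed from a fiberwise opfibration\<close>

text \<open>The choices entering the construction: \<open>cG\<close> is a functorial cleavage of \<open>G\<close>, \<open>cF\<close> chooses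
  the cartesian liftings of \<open>F\<close> above those of \<open>cG\<close>, and \<open>cP \<beta> x\<close> is an opcartesian lifting of the
  \<open>G\<close>-vertical arrow \<open>\<beta>\<close> at \<open>x\<close> in the fiber over \<open>F x\<close>.\<close>

definition construction_choices :: "('p, 'b) cat \<Rightarrow> ('xo, 'xa) cat \<Rightarrow> ('xo, 'xa, 'p, 'b) func
    \<Rightarrow> ('mo, 'ma) cat \<Rightarrow> ('mo, 'ma, 'p, 'b) func \<Rightarrow> ('xo, 'xa, 'mo, 'ma) func
    \<Rightarrow> ('b \<Rightarrow> 'mo \<Rightarrow> 'ma) \<Rightarrow> ('b \<Rightarrow> 'xo \<Rightarrow> 'xa) \<Rightarrow> ('ma \<Rightarrow> 'xo \<Rightarrow> 'xa) \<Rightarrow> bool" where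
  "construction_choices A X F M G P cG cF cP \<longleftrightarrow>
     functorial_cleavage M A G cG \<and>
     cleavage X A F cF \<and>
     (\<forall>x\<in>Obj X. \<forall>\<alpha>\<in>Arr A. Cod A \<alpha> = OMap F x \<longrightarrow> AMap P (cF \<alpha> x) = cG \<alpha> (OMap P x)) \<and>
     (\<forall>a\<in>Obj A. opcleavage (fiber X A F a) (fiber M A G a) P cP)"

text \<open>Such choices always exist: the comparison isomorphism between \<open>P f\<close>, for \<open>f\<close> an arbitrary
  cartesian lifting, and the chosen lifting in \<open>M\<close> can itself be lifted along \<open>P\<close>.\<close>

lemma construction_choices_exist:
  assumes P: "fib_1cell A (X, F) (M, G) P"
    and op: "fiberwise_opfibration A X F M G P"
    and cG: "functorial_cleavage M A G cG"
  shows "\<exists>cF cP. construction_choices A X F M G P cG cF cP"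
proof -
  from P obtain c0 where F: "is_functor X A F" and c0: "cleavage X A F c0"
    and G: "is_functor M A G" and PF: "is_functor X M P" and GP: "func_eq X (G \<odot> P) F"
    and Pcart: "\<And>f. cartesian X A F f \<Longrightarrow> cartesian M A G (AMap P f)"
    by (auto simp: fibration_def)
  interpret F: is_functor X A F by fact
  interpret G: is_functor M A G by fact
  interpret P: is_functor X M P by fact
  have GPo: "OMap G (OMap P x) = OMap F x" if "x \<in> Obj X" for x
    using GP that by (simp add: func_eq_def func_comp_def)
  have GPa: "AMap G (AMap P f) = AMap F f" if "f \<in> Arr X" for f
    using GP that by (simp add: func_eq_def func_comp_def)
  have "\<forall>a. \<exists>c. a \<in> Obj A \<longrightarrow> opcleavage (fiber X A F a) (fiber M A G a) P c"
    using op by (auto simp: fiberwise_opfibration_def opfibration_def)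
  then obtain c where c: "\<And>a. a \<in> Obj A \<Longrightarrow> opcleavage (fiber X A F a) (fiber M A G a) P (c a)"
    by metis
  define cP where "cP = (\<lambda>\<beta> x. c (OMap F x) \<beta> x)"
  have cP: "opcleavage (fiber X A F a) (fiber M A G a) P cP" if "a \<in> Obj A" for a
    using c[OF that] by (auto simp: opcleavage_def cP_def fiber_def)
  have "\<exists>f. cartesian X A F f \<and> Cod X f = x \<and> AMap F f = \<alpha> \<and> AMap P f = cG \<alpha> (OMap P x)"
    if x: "x \<in> Obj X" and \<alpha>: "\<alpha> \<in> Arr A" "Cod A \<alpha> = OMap F x" for x \<alpha>
  proof -
    define f where "f = c0 \<alpha> x"
    define g where "g = cG \<alpha> (OMap P x)"
    define y where "y = Dom X f"
    define z where "z = Dom M g"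
    define a where "a = OMap F y"
    have f: "cartesian X A F f" "f \<in> hom X y x" "AMap F f = \<alpha>"
      using c0 x \<alpha> by (auto simp: cleavage_def f_def y_def cartesian_def hom_def)
    have y: "y \<in> Obj X" using f F.dom.dom_obj by (auto simp: hom_def)
    have g: "cartesian M A G g" "g \<in> hom M z (OMap P x)" "AMap G g = \<alpha>"
      using cG x \<alpha> P.map_obj GPo
      by (auto simp: functorial_cleavage_def cleavage_def g_def z_def cartesian_def hom_def)
    have z: "z \<in> Obj M" using g G.dom.dom_obj by (auto simp: hom_def)
    have Pf: "AMap P f \<in> hom M (OMap P y) (OMap P x)" using P.map_hom f by blast
    have a: "a \<in> Obj A" "OMap G z = a" "OMap G (OMap P y) = a" "\<alpha> \<in> hom A a (OMap F x)"
      using F.map_hom[OF f(2)] G.map_hom[OF g(2)] f g y GPo F.map_obj[OF y]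
      by (auto simp: a_def hom_def)
    have a1: "\<alpha> \<cdot>\<^bsub>A\<^esub> Ident A a = \<alpha>" "Ident A a \<in> hom A a a"
      using F.cod.hom_ident a(4) F.cod.ident_hom a(1) by auto
    have up: "\<exists>!k. k \<in> hom M w z' \<and> AMap G k = Ident A a \<and> q \<cdot>\<^bsub>M\<^esub> k = p"
      if "cartesian M A G q" "q \<in> hom M z' (OMap P x)" "AMap G q = \<alpha>" "OMap G z' = a"
         "p \<in> hom M w (OMap P x)" "AMap G p = \<alpha>" "OMap G w = a" for q p w z'
    proof -
      have "p \<in> Arr M" "Ident A a \<in> hom A (OMap G (Dom M p)) (OMap G (Dom M q))"
        "Cod M p = Cod M q \<and> AMap G q \<cdot>\<^bsub>A\<^esub> Ident A a = AMap G p"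
        using that a1 by (auto simp: hom_def)
      then have "\<exists>!k. k \<in> hom M (Dom M p) (Dom M q) \<and> AMap G k = Ident A a \<and> q \<cdot>\<^bsub>M\<^esub> k = p"
        using that(1) unfolding cartesian_def by blast
      moreover have "Dom M p = w" "Dom M q = z'" using that by (auto simp: hom_def)
      ultimately show ?thesis by simp
    qed
    have cf: "cartesian M A G (AMap P f)" "AMap G (AMap P f) = \<alpha>"
      using Pcart f GPa by (auto simp: hom_def)
    obtain i where i: "i \<in> hom M (OMap P y) z" "AMap G i = Ident A a" "g \<cdot>\<^bsub>M\<^esub> i = AMap P f"
      using up[OF g a(2) Pf cf(2) a(3)] by blast
    obtain j where j: "j \<in> hom M z (OMap P y)" "AMap G j = Ident A a" "AMap P f \<cdot>\<^bsub>M\<^esub> j = g"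
      using up[OF cf(1) Pf cf(2) a(3) g(2,3) a(2)] by blast
    have a11: "Ident A a \<cdot>\<^bsub>A\<^esub> Ident A a = Ident A a"
      using F.cod.hom_ident a1 by blast
    have Py: "OMap P y \<in> Obj M" using y P.map_obj by auto
    have ji: "j \<cdot>\<^bsub>M\<^esub> i = Ident M (OMap P y)"
    proof -
      have 1: "j \<cdot>\<^bsub>M\<^esub> i \<in> hom M (OMap P y) (OMap P y)" "AMap G (j \<cdot>\<^bsub>M\<^esub> i) = Ident A a"
        "AMap P f \<cdot>\<^bsub>M\<^esub> (j \<cdot>\<^bsub>M\<^esub> i) = AMap P f"
        using G.dom.comp_hom[OF i(1) j(1)] G.map_comp[OF i(1) j(1)] i j a11
          G.dom.comp_assoc[OF i(1) j(1) Pf] by auto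
      have 2: "Ident M (OMap P y) \<in> hom M (OMap P y) (OMap P y)"
        "AMap G (Ident M (OMap P y)) = Ident A a"
        "AMap P f \<cdot>\<^bsub>M\<^esub> Ident M (OMap P y) = AMap P f"
        using G.dom.ident_hom Py G.map_ident a G.dom.hom_ident Pf by auto
      show ?thesis using up[OF cf(1) Pf cf(2) a(3) Pf cf(2) a(3)] 1 2 by blast
    qed
    have ij: "i \<cdot>\<^bsub>M\<^esub> j = Ident M z"
    proof -
      have 1: "i \<cdot>\<^bsub>M\<^esub> j \<in> hom M z z" "AMap G (i \<cdot>\<^bsub>M\<^esub> j) = Ident A a"
        "g \<cdot>\<^bsub>M\<^esub> (i \<cdot>\<^bsub>M\<^esub> j) = g"
        using G.dom.comp_hom[OF j(1) i(1)] G.map_comp[OF j(1) i(1)] i j a11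
          G.dom.comp_assoc[OF j(1) i(1) g(2)] by auto
      have 2: "Ident M z \<in> hom M z z" "AMap G (Ident M z) = Ident A a" "g \<cdot>\<^bsub>M\<^esub> Ident M z = g"
        using G.dom.ident_hom z G.map_ident a G.dom.hom_ident g by auto
      show ?thesis using up[OF g a(2) g(2,3) a(2)] 1 2 by blast
    qed
    text \<open>Lift the isomorphism \<open>i\<close> to an isomorphism \<open>u\<close> with inverse \<open>v\<close>.\<close>
    define u where "u = cP i y"
    define y' where "y' = Cod X u"
    have u: "opcartesian (fiber X A F a) (fiber M A G a) P u" "Dom X u = y" "AMap P u = i"
      using cP[OF a(1)] y i by (auto simp: opcleavage_def u_def fiber_def hom_def a_def)
    have uX: "u \<in> hom X y y'" "AMap F u = Ident A a"
      using u by (auto simp: opcartesian_def fiber_def hom_def y'_def)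
    have y': "y' \<in> Obj X" using uX F.dom.cod_obj by (auto simp: hom_def)
    have Py': "OMap P y' = z" using P.map_hom[OF uX(1)] u(3) i by (auto simp: hom_def)
    have Fy': "OMap F y' = a" using GPo[OF y'] Py' a by simp
    have upu: "\<exists>!h. h \<in> hom X y' w \<and> AMap F h = Ident A a \<and> AMap P h = \<gamma> \<and> h \<cdot>\<^bsub>X\<^esub> u = t"
      if "t \<in> hom X y w" "AMap F t = Ident A a" "\<gamma> \<in> hom M z (OMap P w)"
         "AMap G \<gamma> = Ident A a" "\<gamma> \<cdot>\<^bsub>M\<^esub> i = AMap P t" for t w \<gamma>
    proof -
      have "t \<in> Arr (fiber X A F a)" "\<gamma> \<in> hom (fiber M A G a) (OMap P (Cod (fiber X A F a) u)) (OMap P (Cod (fiber X A F a) t))"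
        "Dom (fiber X A F a) t = Dom (fiber X A F a) u" "\<gamma> \<cdot>\<^bsub>fiber M A G a\<^esub> AMap P u = AMap P t"
        using that u Py' by (auto simp: fiber_def hom_def y'_def)
      then have "\<exists>!h. h \<in> hom (fiber X A F a) (Cod (fiber X A F a) u) (Cod (fiber X A F a) t)
          \<and> AMap P h = \<gamma> \<and> h \<cdot>\<^bsub>fiber X A F a\<^esub> u = t"
        using u(1) unfolding opcartesian_def by blast
      then show ?thesis using that(1) by (simp add: fiber_def hom_def y'_def conj_ac)
    qed
    have idy: "Ident X y \<in> hom X y y" "AMap F (Ident X y) = Ident A a"
        "AMap P (Ident X y) = Ident M (OMap P y)"
      using F.dom.ident_hom F.map_ident P.map_ident y by (auto simp: a_def)
    obtain v where v: "v \<in> hom X y' y" "AMap F v = Ident A a" "AMap P v = j"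
        "v \<cdot>\<^bsub>X\<^esub> u = Ident X y"
      using upu[OF idy(1,2) j(1,2)] ji idy by auto
    have uv: "u \<cdot>\<^bsub>X\<^esub> v = Ident X y'"
    proof -
      have 1: "u \<cdot>\<^bsub>X\<^esub> v \<in> hom X y' y'" "AMap F (u \<cdot>\<^bsub>X\<^esub> v) = Ident A a" "AMap P (u \<cdot>\<^bsub>X\<^esub> v) = Ident M z"
        "(u \<cdot>\<^bsub>X\<^esub> v) \<cdot>\<^bsub>X\<^esub> u = u"
        using F.dom.comp_hom[OF v(1) uX(1)] F.map_comp[OF v(1) uX(1)] uX v a11
          P.map_comp[OF v(1) uX(1)] u(3) ij F.dom.comp_assoc[OF uX(1) v(1) uX(1)]
          F.dom.hom_ident[OF uX(1)] by auto
      have 2: "Ident X y' \<in> hom X y' y'" "AMap F (Ident X y') = Ident A a"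
        "AMap P (Ident X y') = Ident M z" "Ident X y' \<cdot>\<^bsub>X\<^esub> u = u"
        using F.dom.ident_hom F.map_ident P.map_ident y' Fy' Py' F.dom.hom_ident[OF uX(1)] by auto
      have zi: "Ident M z \<in> hom M z (OMap P y')" "AMap G (Ident M z) = Ident A a"
        "Ident M z \<cdot>\<^bsub>M\<^esub> i = AMap P u"
        using G.dom.ident_hom z Py' G.map_ident a G.dom.hom_ident[OF i(1)] u by auto
      show ?thesis using upu[OF uX zi] 1 2 by blast
    qed
    define f' where "f' = f \<cdot>\<^bsub>X\<^esub> v"
    have f': "f' \<in> hom X y' x" "AMap F f' = \<alpha>" "AMap P f' = g"
      using F.dom.comp_hom[OF v(1) f(2)] F.map_comp[OF v(1) f(2)] P.map_comp[OF v(1) f(2)]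
        v f j a1 by (auto simp: f'_def)
    have "cartesian X A F f'"
      unfolding cartesian_def
    proof (intro conjI ballI impI; (elim conjE)?)
      show "f' \<in> Arr X" using f' by (simp add: hom_def)
    next
      fix t \<gamma> assume t: "t \<in> Arr X" "\<gamma> \<in> hom A (OMap F (Dom X t)) (OMap F (Dom X f'))"
        "Cod X t = Cod X f'" "AMap F f' \<cdot>\<^bsub>A\<^esub> \<gamma> = AMap F t"
      let ?w = "Dom X t"
      have \<gamma>: "\<gamma> \<in> hom A (OMap F ?w) a" using t f' Fy' by (auto simp: hom_def)
      have \<gamma>1: "Ident A a \<cdot>\<^bsub>A\<^esub> \<gamma> = \<gamma>" using F.cod.hom_ident \<gamma> by blast
      have f_up: "\<exists>!h. h \<in> hom X ?w y \<and> AMap F h = \<gamma> \<and> f \<cdot>\<^bsub>X\<^esub> h = t"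
      proof -
        have "\<gamma> \<in> hom A (OMap F ?w) (OMap F (Dom X f))" "Cod X t = Cod X f \<and> AMap F f \<cdot>\<^bsub>A\<^esub> \<gamma> = AMap F t"
          using f f' t \<gamma> by (auto simp: hom_def a_def)
        then show ?thesis using f(1) t(1) unfolding cartesian_def y_def by blast
      qed
      then obtain h where h: "h \<in> hom X ?w y" "AMap F h = \<gamma>" "f \<cdot>\<^bsub>X\<^esub> h = t" by blast
      show "\<exists>!k. k \<in> hom X ?w (Dom X f') \<and> AMap F k = \<gamma> \<and> f' \<cdot>\<^bsub>X\<^esub> k = t"
      proof (intro ex1I[of _ "u \<cdot>\<^bsub>X\<^esub> h"] conjI)
        show "u \<cdot>\<^bsub>X\<^esub> h \<in> hom X ?w (Dom X f')"
          using F.dom.comp_hom[OF h(1) uX(1)] f' by (simp add: hom_def)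
        show "AMap F (u \<cdot>\<^bsub>X\<^esub> h) = \<gamma>" using F.map_comp[OF h(1) uX(1)] h uX \<gamma>1 by simp
        have "v \<cdot>\<^bsub>X\<^esub> (u \<cdot>\<^bsub>X\<^esub> h) = h"
          using F.dom.comp_assoc[OF h(1) uX(1) v(1)] v(4) F.dom.hom_ident[OF h(1)] by simp
        then show "f' \<cdot>\<^bsub>X\<^esub> (u \<cdot>\<^bsub>X\<^esub> h) = t"
          using F.dom.comp_assoc[OF F.dom.comp_hom[OF h(1) uX(1)] v(1) f(2)] h
          by (simp add: f'_def)
      next
        fix k assume k': "k \<in> hom X ?w (Dom X f') \<and> AMap F k = \<gamma> \<and> f' \<cdot>\<^bsub>X\<^esub> k = t"
        then have k: "k \<in> hom X ?w y'" "AMap F k = \<gamma>" "f' \<cdot>\<^bsub>X\<^esub> k = t"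
          using f' by (auto simp: hom_def)
        have "v \<cdot>\<^bsub>X\<^esub> k = h"
          using f_up h F.dom.comp_hom[OF k(1) v(1)] F.map_comp[OF k(1) v(1)] k v \<gamma>1
            F.dom.comp_assoc[OF k(1) v(1) f(2)] by (metis f'_def)
        then show "k = u \<cdot>\<^bsub>X\<^esub> h"
          using F.dom.comp_assoc[OF k(1) v(1) uX(1)] uv F.dom.hom_ident[OF k(1)] by simp
      qed
    qed
    then show ?thesis using f' by (auto simp: g_def hom_def)
  qed
  note lift = this
  define cF where "cF = (\<lambda>\<alpha> x. SOME f. cartesian X A F f \<and> Cod X f = x \<and> AMap F f = \<alpha> \<and>
      AMap P f = cG \<alpha> (OMap P x))"
  have "cartesian X A F (cF \<alpha> x) \<and> Cod X (cF \<alpha> x) = x \<and> AMap F (cF \<alpha> x) = \<alpha> \<and>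
      AMap P (cF \<alpha> x) = cG \<alpha> (OMap P x)"
    if "x \<in> Obj X" "\<alpha> \<in> Arr A" "Cod A \<alpha> = OMap F x" for x \<alpha>
    unfolding cF_def by (rule someI_ex[OF lift[OF that]])
  then have "construction_choices A X F M G P cG cF cP"
    using cG cP by (auto simp: construction_choices_def cleavage_def)
  then show ?thesis by blast
qed

definition zigzag :: "('xo, 'xa) cat \<Rightarrow> ('mo, 'ma) cat \<Rightarrow> ('xo, 'xa, 'mo, 'ma) func
    \<Rightarrow> ('xo \<times> 'xo) set" where
  "zigzag X M P =
     (let R = {(Dom X v, Cod X v) | v. vertical X M P v} in (R \<union> R\<inverse>)\<^sup>* \<inter> Obj X \<times> Obj X)"

definition vclass :: "('xo, 'xa) cat \<Rightarrow> ('mo, 'ma) cat \<Rightarrow> ('xo, 'xa, 'mo, 'ma) func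
    \<Rightarrow> 'xo \<Rightarrow> 'xo set" where
  "vclass X M P x = zigzag X M P `` {x}"

text \<open>An arrow \<open>\<mu> : U \<rightarrow> V\<close> is stored as \<open>(U, \<mu>, V)\<close>. The condition on \<open>\<mu>\<close> is stated for some
  representatives; it does not depend on them. The functor \<open>P\<close> is constant on classes, so that
  \<open>the_elem (OMap P ` U)\<close> is the common value of \<open>P\<close> on \<open>U\<close> (and similarly for \<open>F\<close>).\<close>

definition bar_arrow :: "('p, 'b) cat \<Rightarrow> ('xo, 'xa) cat \<Rightarrow> ('xo, 'xa, 'p, 'b) func
    \<Rightarrow> ('mo, 'ma) cat \<Rightarrow> ('mo, 'ma, 'p, 'b) func \<Rightarrow> ('xo, 'xa, 'mo, 'ma) func
    \<Rightarrow> ('b \<Rightarrow> 'xo \<Rightarrow> 'xa) \<Rightarrow> ('ma \<Rightarrow> 'xo \<Rightarrow> 'xa) \<Rightarrow> 'xo \<Rightarrow> 'ma \<Rightarrow> 'xo \<Rightarrow> bool" where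
  "bar_arrow A X F M G P cF cP x1 \<mu> x2 \<longleftrightarrow>
     \<mu> \<in> hom M (OMap P x1) (OMap P x2) \<and>
     (let \<alpha> = AMap G \<mu>;
          \<beta> = (THE \<beta>. \<beta> \<in> hom M (OMap P x1) (OMap P (Dom X (cF \<alpha> x2))) \<and>
                       AMap P (cF \<alpha> x2) \<cdot>\<^bsub>M\<^esub> \<beta> = \<mu> \<and> AMap G \<beta> = Ident A (OMap F x1))
      in vclass X M P (Cod X (cP \<beta> x1)) = vclass X M P (Dom X (cF \<alpha> x2)))"

definition bar_cat :: "('p, 'b) cat \<Rightarrow> ('xo, 'xa) cat \<Rightarrow> ('xo, 'xa, 'p, 'b) func
    \<Rightarrow> ('mo, 'ma) cat \<Rightarrow> ('mo, 'ma, 'p, 'b) func \<Rightarrow> ('xo, 'xa, 'mo, 'ma) func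
    \<Rightarrow> ('b \<Rightarrow> 'xo \<Rightarrow> 'xa) \<Rightarrow> ('ma \<Rightarrow> 'xo \<Rightarrow> 'xa) \<Rightarrow> ('xo set, 'xo set \<times> 'ma \<times> 'xo set) cat" where
  "bar_cat A X F M G P cF cP =
     \<lparr> Obj = Obj X // zigzag X M P,
       Arr = {(U, \<mu>, V). U \<in> Obj X // zigzag X M P \<and> V \<in> Obj X // zigzag X M P \<and>
                (\<exists>x1\<in>U. \<exists>x2\<in>V. bar_arrow A X F M G P cF cP x1 \<mu> x2)},
       Dom = (\<lambda>(U, _, _). U),
       Cod = (\<lambda>(_, _, V). V),
       Ident = (\<lambda>U. (U, Ident M (the_elem (OMap P ` U)), U)),
       Comp = (\<lambda>(_, \<nu>, W) (U, \<mu>, _). (U, \<nu> \<cdot>\<^bsub>M\<^esub> \<mu>, W)) \<rparr>"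

definition bar_proj :: "('xo, 'xa, 'p, 'b) func \<Rightarrow> ('mo, 'ma, 'p, 'b) func
    \<Rightarrow> ('xo set, 'xo set \<times> 'ma \<times> 'xo set, 'p, 'b) func" where
  "bar_proj F G = \<lparr>OMap = (\<lambda>U. the_elem (OMap F ` U)), AMap = (\<lambda>(_, \<mu>, _). AMap G \<mu>)\<rparr>"

definition bar_Q :: "('xo, 'xa) cat \<Rightarrow> ('mo, 'ma) cat \<Rightarrow> ('xo, 'xa, 'mo, 'ma) func
    \<Rightarrow> ('xo, 'xa, 'xo set, 'xo set \<times> 'ma \<times> 'xo set) func" where
  "bar_Q X M P =
     \<lparr> OMap = vclass X M P,
       AMap = (\<lambda>\<xi>. (vclass X M P (Dom X \<xi>), AMap P \<xi>, vclass X M P (Cod X \<xi>))) \<rparr>"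

end

theory Submission
  imports Defs
begin

text \<open>
  Write \<open>x \<approx> y\<close> when a zig-zag of \<open>P\<close>-vertical arrows connects \<open>x\<close> and \<open>y\<close>, so that the objects of
  the constructed category are the \<open>\<approx>\<close>-classes. The theorem rests on two facts, one about its
  arrows and one about discrete opfibrations.

  First, every arrow between the classes of \<open>x1\<close> and \<open>x2\<close> is a composite \<open>Q f \<cdot> Q u\<close>, where
  \<open>u : x1 \<rightarrow> y\<close> and \<open>f : y' \<rightarrow> x2\<close> need not compose in \<open>X\<close> but \<open>y \<approx> y'\<close>
  (\<open>bar_arrow_factors_through_Q\<close>); by definition \<open>u\<close> can be an opcartesian lifting in a fiber and
  \<open>f\<close> a cartesian lifting. Conversely any such pair with \<open>u\<close> vertical over \<open>A\<close> gives an arrow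
  (\<open>arrowI\<close>). This description also carries the construction: composition exchanges the
  cartesian half of one arrow with the vertical half of the next (\<open>arrow_comp\<close>), and the images under
  \<open>Q\<close> of the chosen cartesian liftings are cartesian (\<open>Q_pull_cartesian\<close>), which is where the splitting
  of \<open>G\<close> enters.

  Second, a discrete opfibration \<open>g\<close> in the 2-category of fibrations over \<open>A\<close> determines vertical
  arrows with given source by their image; since cartesian liftings reduce arbitrary arrows to
  vertical ones, \<open>g\<close> is faithful (\<open>discrete_opfibration_faithful\<close>), and it reflects identities
  (\<open>discrete_opfibration_reflects_identities\<close>).

  Now let \<open>g \<cdot> h = k \<cdot> Q\<close>. A diagonal \<open>d\<close> must send the class of \<open>x\<close> to \<open>h x\<close>. This is consistent: for a
  \<open>P\<close>-vertical \<open>v\<close> the arrow \<open>Q v\<close> is an identity, hence so is \<open>g (h v) = k (Q v)\<close>, hence so is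
  \<open>h v\<close>. An arrow \<open>\<mu> = Q f \<cdot> Q u\<close> must go to an arrow above \<open>k \<mu>\<close>; by faithfulness there is at
  most one with the required ends, and \<open>h f \<cdot> h u\<close>, which makes sense because \<open>h y = h y'\<close>, is
  one. Functoriality, commutation with \<open>h\<close> and uniqueness then follow by comparing images under
  \<open>g\<close>. Finally \<open>d\<close> preserves cartesian arrows because it sends the liftings \<open>Q (cF \<alpha> x)\<close>, to which
  \<open>preserves_cartesian_if_on_cleavage\<close> reduces the question, to \<open>h (cF \<alpha> x)\<close>.
\<close>

section \<open>Cartesian arrows\<close>

context is_functor
begin

lemma cartesianI:
  assumes "f \<in> hom C y x"
    and "\<And>w g \<gamma>. \<lbrakk>g \<in> hom C w x; \<gamma> \<in> hom D (OMap F w) (OMap F y); AMap F f \<cdot>\<^bsub>D\<^esub> \<gamma> = AMap F g\<rbrakk>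
      \<Longrightarrow> \<exists>!h. h \<in> hom C w y \<and> AMap F h = \<gamma> \<and> f \<cdot>\<^bsub>C\<^esub> h = g"
  shows "cartesian C D F f"
  using assms by (auto simp: cartesian_def hom_def)

lemma cartesian_ex1:
  assumes "cartesian C D F f" "f \<in> hom C y x" "g \<in> hom C w x"
    and "\<gamma> \<in> hom D (OMap F w) (OMap F y)" "AMap F f \<cdot>\<^bsub>D\<^esub> \<gamma> = AMap F g"
  shows "\<exists>!h. h \<in> hom C w y \<and> AMap F h = \<gamma> \<and> f \<cdot>\<^bsub>C\<^esub> h = g"
proof -
  have "g \<in> Arr C" "\<gamma> \<in> hom D (OMap F (Dom C g)) (OMap F (Dom C f))" "Cod C g = Cod C f"
    "Dom C g = w" "Dom C f = y"
    using assms by (auto simp: hom_def)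
  with assms(1,5) show ?thesis unfolding cartesian_def by blast
qed

lemma cartesian_cancel:
  assumes "cartesian C D F f" "f \<in> hom C y x" "h \<in> hom C w y" "h' \<in> hom C w y"
    and "AMap F h = AMap F h'" "f \<cdot>\<^bsub>C\<^esub> h = f \<cdot>\<^bsub>C\<^esub> h'"
  shows "h = h'"
  using cartesian_ex1[OF assms(1,2) dom.comp_hom[OF assms(4,2)] map_hom[OF assms(4)]]
    map_comp[OF assms(4,2)] assms(3-) by auto

text \<open>The case of \<open>cartesian_ex1\<close> in which the two arrows have the same image, so that the factor is
  vertical.\<close>

lemma cartesian_factor:
  assumes "cartesian C D F f" "f \<in> hom C y x" "g \<in> hom C w x" "AMap F g = AMap F f"
  obtains h where "h \<in> hom C w y" "AMap F h = Ident D (OMap F w)" "f \<cdot>\<^bsub>C\<^esub> h = g"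
    and "OMap F w = OMap F y"
proof -
  have eq: "OMap F w = OMap F y" using map_hom[OF assms(2)] map_hom[OF assms(3)] assms(4)
    by (auto simp: hom_def)
  have "w \<in> Obj C" using assms(3) dom.dom_obj by (auto simp: hom_def)
  then have i: "Ident D (OMap F w) \<in> hom D (OMap F w) (OMap F y)"
    using cod.ident_hom map_obj eq by metis
  have "AMap F f \<cdot>\<^bsub>D\<^esub> Ident D (OMap F w) = AMap F g"
    using cod.hom_ident(1)[OF map_hom[OF assms(2)]] eq assms(4) by simp
  from cartesian_ex1[OF assms(1-3) i this] show thesis using that eq by blast
qed

lemma cartesian_comp_iso:
  assumes f: "cartesian C D F f" "f \<in> hom C y x"
    and i: "i \<in> hom C z y" and j: "j \<in> hom C y z"
    and ji: "j \<cdot>\<^bsub>C\<^esub> i = Ident C z" and ij: "i \<cdot>\<^bsub>C\<^esub> j = Ident C y"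
  shows "cartesian C D F (f \<cdot>\<^bsub>C\<^esub> i)"
proof (rule cartesianI)
  show "f \<cdot>\<^bsub>C\<^esub> i \<in> hom C z x" using dom.comp_hom[OF i f(2)] .
next
  fix w g \<gamma>
  assume g: "g \<in> hom C w x" and \<gamma>: "\<gamma> \<in> hom D (OMap F w) (OMap F z)"
    and eq: "AMap F (f \<cdot>\<^bsub>C\<^esub> i) \<cdot>\<^bsub>D\<^esub> \<gamma> = AMap F g"
  have z: "z \<in> Obj C" using i dom.dom_obj by (auto simp: hom_def)
  have i\<gamma>: "AMap F i \<cdot>\<^bsub>D\<^esub> \<gamma> \<in> hom D (OMap F w) (OMap F y)"
    using cod.comp_hom[OF \<gamma> map_hom[OF i]] .
  have "AMap F f \<cdot>\<^bsub>D\<^esub> (AMap F i \<cdot>\<^bsub>D\<^esub> \<gamma>) = AMap F g"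
    using eq map_comp[OF i f(2)] cod.comp_assoc[OF \<gamma> map_hom[OF i] map_hom[OF f(2)]] by simp
  from cartesian_ex1[OF f g i\<gamma> this] obtain h where h: "h \<in> hom C w y"
    "AMap F h = AMap F i \<cdot>\<^bsub>D\<^esub> \<gamma>" "f \<cdot>\<^bsub>C\<^esub> h = g" by blast
  have j\<gamma>: "AMap F j \<cdot>\<^bsub>D\<^esub> (AMap F i \<cdot>\<^bsub>D\<^esub> \<gamma>) = \<gamma>"
    using cod.comp_assoc[OF \<gamma> map_hom[OF i] map_hom[OF j]] map_comp[OF i j] ji map_ident[OF z]
      cod.hom_ident(2)[OF \<gamma>] by simp
  show "\<exists>!k. k \<in> hom C w z \<and> AMap F k = \<gamma> \<and> f \<cdot>\<^bsub>C\<^esub> i \<cdot>\<^bsub>C\<^esub> k = g"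
  proof (intro ex1I[of _ "j \<cdot>\<^bsub>C\<^esub> h"] conjI)
    show jh: "j \<cdot>\<^bsub>C\<^esub> h \<in> hom C w z" using dom.comp_hom[OF h(1) j] .
    show "AMap F (j \<cdot>\<^bsub>C\<^esub> h) = \<gamma>" using map_comp[OF h(1) j] h(2) j\<gamma> by simp
    show "f \<cdot>\<^bsub>C\<^esub> i \<cdot>\<^bsub>C\<^esub> (j \<cdot>\<^bsub>C\<^esub> h) = g"
      using dom.comp_assoc[OF jh i f(2)] dom.comp_assoc[OF h(1) j i] ij
        dom.hom_ident(2)[OF h(1)] h(3) by simp
  next
    fix k assume "k \<in> hom C w z \<and> AMap F k = \<gamma> \<and> f \<cdot>\<^bsub>C\<^esub> i \<cdot>\<^bsub>C\<^esub> k = g"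
    then have k: "k \<in> hom C w z" "AMap F k = \<gamma>" "f \<cdot>\<^bsub>C\<^esub> i \<cdot>\<^bsub>C\<^esub> k = g" by auto
    have "i \<cdot>\<^bsub>C\<^esub> k = h"
      using cartesian_cancel[OF f dom.comp_hom[OF k(1) i] h(1)] map_comp[OF k(1) i] k h(2,3)
        dom.comp_assoc[OF k(1) i f(2)] by simp
    then show "k = j \<cdot>\<^bsub>C\<^esub> h"
      using dom.comp_assoc[OF k(1) i j] ji dom.hom_ident(2)[OF k(1)] by simp
  qed
qed

lemma cartesian_comparison_iso:
  assumes f: "cartesian C D F f" "f \<in> hom C y x" and g: "cartesian C D F g" "g \<in> hom C z x"
    and eq: "AMap F g = AMap F f"
  obtains i j where "i \<in> hom C z y" "j \<in> hom C y z" "f \<cdot>\<^bsub>C\<^esub> i = g"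
    "j \<cdot>\<^bsub>C\<^esub> i = Ident C z" "i \<cdot>\<^bsub>C\<^esub> j = Ident C y"
proof -
  have y: "y \<in> Obj C" and z: "z \<in> Obj C" using f g dom.dom_obj by (auto simp: hom_def)
  obtain i where i: "i \<in> hom C z y" "AMap F i = Ident D (OMap F z)" "f \<cdot>\<^bsub>C\<^esub> i = g"
    and Fzy: "OMap F z = OMap F y"
    using cartesian_factor[OF f g(2) eq] by metis
  obtain j where j: "j \<in> hom C y z" "AMap F j = Ident D (OMap F y)" "g \<cdot>\<^bsub>C\<^esub> j = f"
    using cartesian_factor[OF g f(2) eq[symmetric]] by metis
  have II: "Ident D (OMap F z) \<cdot>\<^bsub>D\<^esub> Ident D (OMap F z) = Ident D (OMap F z)"
    using cod.hom_ident(1)[OF cod.ident_hom[OF map_obj[OF z]]] .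
  have "j \<cdot>\<^bsub>C\<^esub> i = Ident C z"
    using cartesian_cancel[OF g dom.comp_hom[OF i(1) j(1)] dom.ident_hom[OF z]]
      map_comp[OF i(1) j(1)] i j II Fzy map_ident[OF z] dom.comp_assoc[OF i(1) j(1) g(2)]
      dom.hom_ident(1)[OF g(2)] by simp
  moreover have "i \<cdot>\<^bsub>C\<^esub> j = Ident C y"
    using cartesian_cancel[OF f dom.comp_hom[OF j(1) i(1)] dom.ident_hom[OF y]]
      map_comp[OF j(1) i(1)] i j II Fzy map_ident[OF y] dom.comp_assoc[OF j(1) i(1) f(2)]
      dom.hom_ident(1)[OF f(2)] by simp
  ultimately show thesis using that i j by blast
qed

end

text \<open>A cartesian arrow differs from the chosen lifting of its image by an isomorphism, and functors
  preserve isomorphisms; so a functor over \<open>A\<close> preserves all cartesian arrows as soon as it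
  preserves those of one cleavage. Below this serves both for \<open>Q\<close> and for the diagonal filler.\<close>

lemma preserves_cartesian_if_on_cleavage:
  assumes F: "is_functor X A F" and G: "is_functor Y A G" and H: "is_functor X Y H"
    and GH: "func_eq X (G \<odot> H) F" and c: "cleavage X A F c"
    and Hc: "\<And>\<alpha> x. \<lbrakk>x \<in> Obj X; \<alpha> \<in> Arr A; Cod A \<alpha> = OMap F x\<rbrakk>
      \<Longrightarrow> cartesian Y A G (AMap H (c \<alpha> x))"
    and f: "cartesian X A F f"
  shows "cartesian Y A G (AMap H f)"
proof -
  interpret F: is_functor X A F by fact
  interpret G: is_functor Y A G by fact
  interpret H: is_functor X Y H by fact
  define x \<alpha> where "x = Cod X f" and "\<alpha> = AMap F f"
  have fh: "f \<in> hom X (Dom X f) x" using f by (auto simp: cartesian_def hom_def x_def)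
  have x: "x \<in> Obj X" using F.dom.cod_obj fh by (auto simp: hom_def)
  have \<alpha>: "\<alpha> \<in> Arr A" "Cod A \<alpha> = OMap F x" using F.map_hom[OF fh] by (auto simp: hom_def \<alpha>_def)
  have c': "cartesian X A F (c \<alpha> x)" "c \<alpha> x \<in> hom X (Dom X (c \<alpha> x)) x" "AMap F (c \<alpha> x) = \<alpha>"
    using c x \<alpha> by (auto simp: cleavage_def cartesian_def hom_def)
  obtain i j where ij: "i \<in> hom X (Dom X f) (Dom X (c \<alpha> x))" "j \<in> hom X (Dom X (c \<alpha> x)) (Dom X f)"
    "c \<alpha> x \<cdot>\<^bsub>X\<^esub> i = f" "j \<cdot>\<^bsub>X\<^esub> i = Ident X (Dom X f)" "i \<cdot>\<^bsub>X\<^esub> j = Ident X (Dom X (c \<alpha> x))"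
    using F.cartesian_comparison_iso[OF c'(1,2) f fh] c'(3) \<alpha>_def by metis
  have obs: "Dom X f \<in> Obj X" "Dom X (c \<alpha> x) \<in> Obj X"
    using ij(1) F.dom.dom_obj[of i] F.dom.cod_obj[of i] by (auto simp: hom_def)
  have "cartesian Y A G (AMap H (c \<alpha> x) \<cdot>\<^bsub>Y\<^esub> AMap H i)"
    using G.cartesian_comp_iso[OF Hc[OF x \<alpha>] H.map_hom[OF c'(2)] H.map_hom[OF ij(1)]
        H.map_hom[OF ij(2)]]
      H.map_comp[OF ij(1,2)] H.map_comp[OF ij(2,1)] ij(4,5) H.map_ident obs by simp
  then show ?thesis using H.map_comp[OF ij(1) c'(2)] ij(3) by simp
qed

section \<open>Discrete opfibrations in the 2-category of fibrations\<close>

text \<open>An arrow \<open>u\<close> that is vertical over the base, with source \<open>c\<close>, is an object \<open>(c, u, c1)\<close> of the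
  comma category of \<open>C\<close>, which the canonical comparison \<open>r\<close> sends to \<open>(c, g u, g c1)\<close>. Since the counit
  is an identity, \<open>l (r e) = e\<close> for the adjoint \<open>l\<close>, so that \<open>r\<close> is injective on objects.\<close>

lemma discrete_opfibration_vertical_determined:
  assumes g: "discrete_opfibration A (C, K) (D, L) g"
    and u: "u \<in> hom C c c1" "AMap K u = Ident A (OMap K c)"
    and v: "v \<in> hom C c c2" "AMap K v = Ident A (OMap K c)"
    and eq: "AMap g u = AMap g v"
  shows "u = v \<and> c1 = c2"
proof -
  from g have "fib_1cell A (C, K) (D, L) g" by (simp add: discrete_opfibration_def)
  then interpret g: is_functor C D g by simp
  let ?E = "comma_cat A (C, K) (C, K) func_id"
  obtain l \<eta> \<epsilon> where adj: "fib_adjunction A (comma_over A (C, K) (C, K) func_id)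
      (comma_over A (C, K) (D, L) g) l (comma_comparison g) \<eta> \<epsilon>"
    and \<epsilon>: "\<forall>e\<in>Obj (fst (comma_over A (C, K) (C, K) func_id)).
      \<epsilon> e = Ident (fst (comma_over A (C, K) (C, K) func_id)) e"
    using g unfolding discrete_opfibration_def Let_def by blast
  have lr: "OMap l (OMap (comma_comparison g) e) = e" if e: "e \<in> Obj ?E" for e
  proof -
    have "fib_2cell A (comma_over A (C, K) (C, K) func_id) (comma_over A (C, K) (C, K) func_id)
        (l \<odot> comma_comparison g) func_id \<epsilon>"
      using adj unfolding comma_over_def fib_adjunction.simps by blast
    then have "\<epsilon> e \<in> hom ?E (OMap (l \<odot> comma_comparison g) e) e"
      using e unfolding comma_over_def fib_2cell.simps by (auto simp: func_id_def)
    moreover have "Dom ?E (\<epsilon> e) = e"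
      using \<epsilon> e by (cases e) (simp add: comma_over_def comma_cat_def)
    ultimately show ?thesis by (simp add: hom_def func_comp_def)
  qed
  have objs: "c \<in> Obj C" "c1 \<in> Obj C" "c2 \<in> Obj C"
    using u v g.dom.dom_obj g.dom.cod_obj by (auto simp: hom_def)
  have E: "(c, u, c1) \<in> Obj ?E" "(c, v, c2) \<in> Obj ?E"
    using u v objs by (auto simp: comma_cat_def comma_objs_def func_id_def)
  have "OMap g c1 = OMap g c2" using g.map_hom[OF u(1)] g.map_hom[OF v(1)] eq by (auto simp: hom_def)
  then have "OMap (comma_comparison g) (c, u, c1) = OMap (comma_comparison g) (c, v, c2)"
    using eq by (simp add: comma_comparison_def Let_def)
  then have "(c, u, c1) = (c, v, c2)" using lr[OF E(1)] lr[OF E(2)] by metis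
  then show ?thesis by simp
qed

text \<open>An arrow over an identity is vertical over the base, so it can be compared with the identity
  of its source.\<close>

lemma discrete_opfibration_reflects_identities:
  assumes g: "discrete_opfibration A (C, K) (D, L) g"
    and u: "u \<in> hom C c c'" and gu: "AMap g u = Ident D (OMap g c)"
  shows "c' = c \<and> u = Ident C c"
proof -
  from g have cell: "fib_1cell A (C, K) (D, L) g" by (simp add: discrete_opfibration_def)
  then interpret g: is_functor C D g by simp
  from cell interpret K: is_functor C A K by (simp add: fibration_def)
  from cell interpret L: is_functor D A L by (simp add: fibration_def)
  have c: "c \<in> Obj C" using u g.dom.dom_obj by (auto simp: hom_def)
  have "AMap K u = AMap L (AMap g u)" "OMap K c = OMap L (OMap g c)"
    using cell u c by (auto simp: func_eq_def func_comp_def hom_def)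
  then have "AMap K u = Ident A (OMap K c)" using gu L.map_ident[OF g.map_obj[OF c]] by simp
  then show ?thesis
    using discrete_opfibration_vertical_determined[OF g u _ g.dom.ident_hom[OF c] K.map_ident[OF c]]
      gu g.map_ident[OF c] by auto
qed

text \<open>Factor both arrows through one cartesian lifting \<open>f\<close> of their common image in the base. As \<open>g f\<close>
  is cartesian, the two vertical factors have the same image under \<open>g\<close>, so they agree.\<close>

lemma discrete_opfibration_faithful:
  assumes g: "discrete_opfibration A (C, K) (D, L) g"
    and u: "u \<in> hom C c c'" and v: "v \<in> hom C c c'" and eq: "AMap g u = AMap g v"
  shows "u = v"
proof -
  from g have cell: "fib_1cell A (C, K) (D, L) g" by (simp add: discrete_opfibration_def)
  then interpret g: is_functor C D g by simp
  from cell interpret K: is_functor C A K by (simp add: fibration_def)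
  from cell interpret L: is_functor D A L by (simp add: fibration_def)
  have LgK: "AMap L (AMap g t) = AMap K t" if "t \<in> Arr C" for t
    using cell that by (simp add: func_eq_def func_comp_def)
  obtain cl where cl: "cleavage C A K cl" using cell by (auto simp: fibration_def)
  define \<alpha> f where "\<alpha> = AMap K u" and "f = cl \<alpha> c'"
  have Kv: "AMap K v = \<alpha>" using LgK[of u] LgK[of v] u v eq by (simp add: \<alpha>_def hom_def)
  have c': "c' \<in> Obj C" using u g.dom.cod_obj by (auto simp: hom_def)
  have \<alpha>: "\<alpha> \<in> Arr A" "Cod A \<alpha> = OMap K c'" using K.map_hom[OF u] by (auto simp: hom_def \<alpha>_def)
  define b where "b = Dom C f"
  have f: "cartesian C A K f" "f \<in> hom C b c'" "AMap K f = \<alpha>"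
    using cl c' \<alpha> by (auto simp: cleavage_def cartesian_def hom_def f_def b_def)
  have gf: "cartesian D A L (AMap g f)" using cell f by simp
  obtain u' where u': "u' \<in> hom C c b" "AMap K u' = Ident A (OMap K c)" "f \<cdot>\<^bsub>C\<^esub> u' = u"
    using K.cartesian_factor[OF f(1,2) u] f(3) \<alpha>_def by metis
  obtain v' where v': "v' \<in> hom C c b" "AMap K v' = Ident A (OMap K c)" "f \<cdot>\<^bsub>C\<^esub> v' = v"
    using K.cartesian_factor[OF f(1,2) v] f(3) Kv by metis
  have "AMap L (AMap g u') = AMap L (AMap g v')"
    using LgK[of u'] LgK[of v'] u' v' by (simp add: hom_def)
  moreover have "AMap g f \<cdot>\<^bsub>D\<^esub> AMap g u' = AMap g f \<cdot>\<^bsub>D\<^esub> AMap g v'"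
    using g.map_comp[OF u'(1) f(2)] g.map_comp[OF v'(1) f(2)] u'(3) v'(3) eq by simp
  ultimately have "AMap g u' = AMap g v'"
    using L.cartesian_cancel[OF gf g.map_hom[OF f(2)] g.map_hom[OF u'(1)] g.map_hom[OF v'(1)]] by blast
  then have "u' = v'" using discrete_opfibration_vertical_determined[OF g u'(1,2) v'(1,2)] by blast
  then show ?thesis using u' v' by simp
qed

section \<open>Zig-zags of vertical arrows, pullback and pushforward\<close>

locale fiberwise_construction =
  F: is_functor X A F + G: is_functor M A G + P: is_functor X M P
  for A :: "('p, 'b) cat"
    and X :: "('xo, 'xa) cat" and F :: "('xo, 'xa, 'p, 'b) func"
    and M :: "('mo, 'ma) cat" and G :: "('mo, 'ma, 'p, 'b) func"
    and P :: "('xo, 'xa, 'mo, 'ma) func" +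
  fixes cG :: "'b \<Rightarrow> 'mo \<Rightarrow> 'ma" and cF :: "'b \<Rightarrow> 'xo \<Rightarrow> 'xa" and cP :: "'ma \<Rightarrow> 'xo \<Rightarrow> 'xa"
  assumes GP_obj: "x \<in> Obj X \<Longrightarrow> OMap G (OMap P x) = OMap F x"
    and GP_arr: "f \<in> Arr X \<Longrightarrow> AMap G (AMap P f) = AMap F f"
    and P_cartesian: "cartesian X A F f \<Longrightarrow> cartesian M A G (AMap P f)"
    and choices: "construction_choices A X F M G P cG cF cP"
begin

abbreviation related :: "'xo \<Rightarrow> 'xo \<Rightarrow> bool"  (infix "\<approx>" 50) where
  "x \<approx> y \<equiv> (x, y) \<in> zigzag X M P"

definition pull :: "'b \<Rightarrow> 'xo \<Rightarrow> 'xo" where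
  "pull \<alpha> x = Dom X (cF \<alpha> x)"

definition push :: "'ma \<Rightarrow> 'xo \<Rightarrow> 'xo" where
  "push \<beta> x = Cod X (cP \<beta> x)"

lemma GP_hom: "f \<in> hom X x y \<Longrightarrow> AMap G (AMap P f) = AMap F f"
  using GP_arr by (simp add: hom_def)

lemma hom_objs: "f \<in> hom X x y \<Longrightarrow> x \<in> Obj X \<and> y \<in> Obj X"
  using F.dom.dom_obj F.dom.cod_obj by (auto simp: hom_def)

lemma pull:
  assumes "x \<in> Obj X" "\<alpha> \<in> hom A a (OMap F x)"
  shows "cartesian X A F (cF \<alpha> x)" "cF \<alpha> x \<in> hom X (pull \<alpha> x) x" "AMap F (cF \<alpha> x) = \<alpha>"
    and "pull \<alpha> x \<in> Obj X" "OMap F (pull \<alpha> x) = a"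
    and "AMap P (cF \<alpha> x) = cG \<alpha> (OMap P x)"
proof -
  have \<alpha>: "\<alpha> \<in> Arr A" "Cod A \<alpha> = OMap F x" "Dom A \<alpha> = a" using assms by (auto simp: hom_def)
  show c: "cartesian X A F (cF \<alpha> x)" "cF \<alpha> x \<in> hom X (pull \<alpha> x) x" "AMap F (cF \<alpha> x) = \<alpha>"
    and "AMap P (cF \<alpha> x) = cG \<alpha> (OMap P x)"
    using choices assms(1) \<alpha>
    by (auto simp: construction_choices_def cleavage_def cartesian_def hom_def pull_def)
  show "pull \<alpha> x \<in> Obj X" using hom_objs c(2) by blast
  show "OMap F (pull \<alpha> x) = a" using F.map_hom[OF c(2)] c(3) \<alpha> by (auto simp: hom_def)
qed

lemma push:
  assumes "x \<in> Obj X" "\<beta> \<in> hom M (OMap P x) m" "AMap G \<beta> = Ident A (OMap F x)"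
  shows "cP \<beta> x \<in> hom X x (push \<beta> x)" "AMap F (cP \<beta> x) = Ident A (OMap F x)"
    "AMap P (cP \<beta> x) = \<beta>" "push \<beta> x \<in> Obj X" "OMap P (push \<beta> x) = m"
    and push_opcartesian:
      "opcartesian (fiber X A F (OMap F x)) (fiber M A G (OMap F x)) P (cP \<beta> x)"
proof -
  have "opcleavage (fiber X A F (OMap F x)) (fiber M A G (OMap F x)) P cP"
    using choices F.map_obj assms(1) by (auto simp: construction_choices_def)
  then have c: "opcartesian (fiber X A F (OMap F x)) (fiber M A G (OMap F x)) P (cP \<beta> x)"
    "Dom X (cP \<beta> x) = x" "AMap P (cP \<beta> x) = \<beta>"
    using assms by (auto simp: opcleavage_def fiber_def hom_def)
  then show "opcartesian (fiber X A F (OMap F x)) (fiber M A G (OMap F x)) P (cP \<beta> x)"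
    "AMap P (cP \<beta> x) = \<beta>" by auto
  show h: "cP \<beta> x \<in> hom X x (push \<beta> x)" and "AMap F (cP \<beta> x) = Ident A (OMap F x)"
    using c by (auto simp: opcartesian_def fiber_def hom_def push_def)
  show "push \<beta> x \<in> Obj X" using h hom_objs by blast
  show "OMap P (push \<beta> x) = m" using P.map_hom[OF h] c(3) assms(2) by (auto simp: hom_def)
qed

text \<open>Existence of factors suffices below, since they only serve as steps of zig-zags; for such a
  step only the image in \<open>M\<close> matters.\<close>

lemma push_factor:
  assumes x: "x \<in> Obj X" and \<beta>: "\<beta> \<in> hom M (OMap P x) m" "AMap G \<beta> = Ident A (OMap F x)"
    and t: "t \<in> hom X x w" "AMap F t = Ident A (OMap F x)"
    and \<gamma>: "\<gamma> \<in> hom M m (OMap P w)" "AMap G \<gamma> = Ident A (OMap F x)" "\<gamma> \<cdot>\<^bsub>M\<^esub> \<beta> = AMap P t"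
  obtains h where "h \<in> hom X (push \<beta> x) w" "AMap P h = \<gamma>"
proof -
  let ?X = "fiber X A F (OMap F x)" and ?M = "fiber M A G (OMap F x)"
  have "t \<in> Arr ?X" "\<gamma> \<in> hom ?M (OMap P (Cod ?X (cP \<beta> x))) (OMap P (Cod ?X t))"
    "Dom ?X t = Dom ?X (cP \<beta> x)" "\<gamma> \<cdot>\<^bsub>?M\<^esub> AMap P (cP \<beta> x) = AMap P t"
    using t \<gamma> push(1,3,5)[OF x \<beta>] by (auto simp: fiber_def hom_def push_def)
  then have "\<exists>!h. h \<in> hom ?X (Cod ?X (cP \<beta> x)) (Cod ?X t) \<and> AMap P h = \<gamma> \<and> h \<cdot>\<^bsub>?X\<^esub> cP \<beta> x = t"
    using push_opcartesian[OF x \<beta>] unfolding opcartesian_def by blast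
  then show thesis using that t(1) by (auto simp: fiber_def hom_def push_def)
qed

lemma related_equiv: "equiv (Obj X) (zigzag X M P)"
proof -
  have "sym (({(Dom X v, Cod X v) |v. vertical X M P v} \<union>
      {(Dom X v, Cod X v) |v. vertical X M P v}\<inverse>)\<^sup>*)"
    by (rule sym_rtrancl) (auto simp: sym_def)
  then show ?thesis
    by (auto simp: equiv_def refl_on_def zigzag_def Let_def sym_def intro!: transI)
qed

lemma related_refl: "x \<in> Obj X \<Longrightarrow> x \<approx> x"
  and related_sym: "x \<approx> y \<Longrightarrow> y \<approx> x"
  and related_trans [trans]: "x \<approx> y \<Longrightarrow> y \<approx> z \<Longrightarrow> x \<approx> z"
  and related_obj: "x \<approx> y \<Longrightarrow> x \<in> Obj X \<and> y \<in> Obj X"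
  using related_equiv by (auto simp: equiv_def refl_on_def zigzag_def Let_def dest: symD transD)

lemma relatedI:
  assumes "v \<in> hom X x y" "m \<in> Obj M" "AMap P v = Ident M m"
  shows "x \<approx> y"
proof -
  have "vertical X M P v" "Dom X v = x" "Cod X v = y"
    using assms by (auto simp: vertical_def hom_def)
  then show ?thesis using hom_objs[OF assms(1)] by (auto simp: zigzag_def Let_def)
qed

text \<open>Zig-zags are handled by proving a property for single \<open>P\<close>-vertical arrows and checking that
  it is stable under reversal and concatenation. The hypothesis \<open>x \<approx> y\<close> is kept in each case because
  properties such as \<open>push \<beta> x \<approx> push \<beta> y\<close> only make sense when \<open>P x = P y\<close>.\<close>

lemma related_induct [consumes 1, case_names refl step sym trans]:
  assumes "x \<approx> y"
    and refl: "\<And>x. x \<in> Obj X \<Longrightarrow> R x x"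
    and step: "\<And>x y v. \<lbrakk>v \<in> hom X x y; OMap P y = OMap P x; AMap P v = Ident M (OMap P x); x \<approx> y\<rbrakk>
      \<Longrightarrow> R x y"
    and sym: "\<And>x y. \<lbrakk>x \<approx> y; R x y\<rbrakk> \<Longrightarrow> R y x"
    and trans: "\<And>x y z. \<lbrakk>x \<approx> y; y \<approx> z; R x y; R y z\<rbrakk> \<Longrightarrow> R x z"
  shows "R x y"
proof -
  have x: "x \<in> Obj X" using related_obj assms(1) by blast
  have st: "x \<approx> y \<and> R x y" if "(x, y) \<in> {(Dom X v, Cod X v) |v. vertical X M P v}" for x y
  proof -
    from that obtain v where v: "v \<in> hom X x y" "vertical X M P v"
      by (auto simp: hom_def vertical_def)
    obtain m where m: "m \<in> Obj M" "AMap P v = Ident M m" using v(2) by (auto simp: vertical_def)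
    have "OMap P x = m" "OMap P y = m"
      using P.map_hom[OF v(1)] m G.dom.ident_hom[OF m(1)] by (auto simp: hom_def)
    then show ?thesis using step[OF v(1)] relatedI[OF v(1) m] m by simp
  qed
  from assms(1) have "(x, y) \<in> ({(Dom X v, Cod X v) |v. vertical X M P v} \<union>
      {(Dom X v, Cod X v) |v. vertical X M P v}\<inverse>)\<^sup>*"
    by (auto simp: zigzag_def Let_def)
  then have "x \<approx> y \<and> R x y"
  proof induction
    case base
    show ?case using refl related_refl x by blast
  next
    case (step y z)
    have "y \<approx> z \<and> R y z"
      using step(2) st[of y z] st[of z y] sym[of z y] related_sym[of z y] by blast
    with step(3) show ?case using trans related_trans by blast
  qed
  then show ?thesis ..
qed

lemma related_P: "x \<approx> y \<Longrightarrow> OMap P x = OMap P y"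
  by (induction rule: related_induct) auto

lemma related_F: "x \<approx> y \<Longrightarrow> OMap F x = OMap F y"
  using related_P GP_obj related_obj by metis

text \<open>By opcartesianness \<open>u\<close> factors through the lifting of \<open>P u\<close> followed by an arrow over an
  identity. This lemma and its dual \<open>chosen_image_related_pull\<close> compute pushforwards and pullbacks
  up to \<open>\<approx>\<close> from arbitrary arrows; they replace explicit comparisons of chosen liftings.\<close>

lemma vertical_related_push:
  assumes u: "u \<in> hom X x y" "AMap F u = Ident A (OMap F x)"
  shows "push (AMap P u) x \<approx> y"
proof -
  have x: "x \<in> Obj X" and y: "y \<in> Obj X" using hom_objs u by auto
  have Pu: "AMap P u \<in> hom M (OMap P x) (OMap P y)" "AMap G (AMap P u) = Ident A (OMap F x)"
    using P.map_hom u GP_hom by auto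
  have Py: "OMap P y \<in> Obj M" using y P.map_obj by auto
  have Fy: "OMap F y = OMap F x"
    using F.map_hom[OF u(1)] u(2) F.cod.ident_hom[OF F.map_obj[OF x]] by (auto simp: hom_def)
  have "AMap G (Ident M (OMap P y)) = Ident A (OMap F x)"
    using G.map_ident[OF Py] GP_obj[OF y] Fy by simp
  then obtain h where "h \<in> hom X (push (AMap P u) x) y" "AMap P h = Ident M (OMap P y)"
    using push_factor[OF x Pu u G.dom.ident_hom[OF Py]] G.dom.hom_ident(2)[OF Pu(1)] by metis
  then show ?thesis using relatedI Py by blast
qed

text \<open>For a \<open>P\<close>-vertical \<open>v : x \<rightarrow> y\<close>, the composite of \<open>v\<close> with the lifting of \<open>\<beta>\<close> at \<open>y\<close> still lies
  over \<open>\<beta>\<close>, so it computes the pushforward of \<open>x\<close> as well.\<close>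

lemma push_related:
  assumes "x \<approx> x'" "\<beta> \<in> hom M (OMap P x) m" "AMap G \<beta> = Ident A (OMap F x)"
  shows "push \<beta> x \<approx> push \<beta> x'"
  using assms
proof (induction rule: related_induct)
  case (refl x)
  then show ?case using push(4) related_refl by blast
next
  case (step x y v)
  have x: "x \<in> Obj X" and y: "y \<in> Obj X" using related_obj step(4) by auto
  have Fxy: "OMap F y = OMap F x" using related_F[OF step(4)] by simp
  have Fv: "AMap F v = Ident A (OMap F x)"
    using GP_hom[OF step(1)] step(3) G.map_ident[OF P.map_obj[OF x]] GP_obj[OF x] by simp
  have c: "cP \<beta> y \<in> hom X y (push \<beta> y)" "AMap F (cP \<beta> y) = Ident A (OMap F x)" "AMap P (cP \<beta> y) = \<beta>"
    using push[OF y, of \<beta> m] step Fxy by auto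
  have "AMap F (cP \<beta> y \<cdot>\<^bsub>X\<^esub> v) = Ident A (OMap F x)"
    using F.map_comp[OF step(1) c(1)] c(2) Fv F.cod.hom_ident(1)[OF F.cod.ident_hom[OF F.map_obj[OF x]]]
    by simp
  moreover have "AMap P (cP \<beta> y \<cdot>\<^bsub>X\<^esub> v) = \<beta>"
    using P.map_comp[OF step(1) c(1)] c(3) step(3) G.dom.hom_ident(1)[OF step(5)] by simp
  ultimately show ?case
    using vertical_related_push[OF F.dom.comp_hom[OF step(1) c(1)]] by simp
next
  case (sym x y)
  then show ?case using related_P[OF sym(1)] related_F[OF sym(1)] related_sym by simp
next
  case (trans x y z)
  then show ?case using related_P[OF trans(1)] related_F[OF trans(1)] related_trans by metis
qed

text \<open>The comparison from \<open>y\<close> to the chosen pullback lies over an identity of \<open>M\<close>, because \<open>f\<close> and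
  the chosen lifting have the same image in \<open>M\<close>, which is cartesian for \<open>G\<close>.\<close>

lemma chosen_image_related_pull:
  assumes f: "f \<in> hom X y x" and Pf: "AMap P f = cG (AMap F f) (OMap P x)"
  shows "y \<approx> pull (AMap F f) x"
proof -
  have x: "x \<in> Obj X" and y: "y \<in> Obj X" using hom_objs f by auto
  let ?c = "cF (AMap F f) x" and ?p = "pull (AMap F f) x"
  note c = pull[OF x F.map_hom[OF f]]
  obtain h where h: "h \<in> hom X y ?p" "AMap F h = Ident A (OMap F y)" "?c \<cdot>\<^bsub>X\<^esub> h = f"
    using F.cartesian_factor[OF c(1,2) f c(3)[symmetric]] by metis
  have Pc: "AMap P ?c \<in> hom M (OMap P ?p) (OMap P x)" using P.map_hom[OF c(2)] .
  have Pyp: "OMap P y = OMap P ?p" using P.map_hom[OF f] Pc Pf c(6) by (auto simp: hom_def)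
  have i: "Ident M (OMap P y) \<in> hom M (OMap P y) (OMap P ?p)"
    using G.dom.ident_hom[OF P.map_obj[OF y]] Pyp by simp
  have "AMap P ?c \<cdot>\<^bsub>M\<^esub> AMap P h = AMap P ?c \<cdot>\<^bsub>M\<^esub> Ident M (OMap P y)"
    using P.map_comp[OF h(1) c(2)] h(3) Pf c(6) G.dom.hom_ident(1)[OF Pc] Pyp by simp
  moreover have "AMap G (AMap P h) = AMap G (Ident M (OMap P y))"
    using GP_hom[OF h(1)] h(2) G.map_ident[OF P.map_obj[OF y]] GP_obj[OF y] by simp
  ultimately have "AMap P h = Ident M (OMap P y)"
    using G.cartesian_cancel[OF P_cartesian[OF c(1)] Pc P.map_hom[OF h(1)] i] by blast
  then show ?thesis using relatedI[OF h(1) P.map_obj[OF y]] by blast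
qed

lemma pull_related:
  assumes "x \<approx> x'" "\<alpha> \<in> hom A a (OMap F x)"
  shows "pull \<alpha> x \<approx> pull \<alpha> x'"
  using assms
proof (induction rule: related_induct)
  case (refl x)
  then show ?case using pull(4) related_refl by blast
next
  case (step x y v)
  have x: "x \<in> Obj X" and y: "y \<in> Obj X" using related_obj step(4) by auto
  have Fv: "AMap F v = Ident A (OMap F x)"
    using GP_hom[OF step(1)] step(3) G.map_ident[OF P.map_obj[OF x]] GP_obj[OF x] by simp
  note c = pull[OF x step(5)]
  have "AMap F (v \<cdot>\<^bsub>X\<^esub> cF \<alpha> x) = \<alpha>"
    using F.map_comp[OF c(2) step(1)] Fv c(3) F.cod.hom_ident(2)[OF step(5)] by simp
  moreover have "AMap P (v \<cdot>\<^bsub>X\<^esub> cF \<alpha> x) = cG \<alpha> (OMap P y)"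
    using P.map_comp[OF c(2) step(1)] step(2,3) c(6) G.dom.hom_ident(2)[OF P.map_hom[OF c(2)]]
    by simp
  ultimately show ?case
    using chosen_image_related_pull[OF F.dom.comp_hom[OF c(2) step(1)]] by simp
next
  case (sym x y)
  then show ?case using related_F[OF sym(1)] related_sym by simp
next
  case (trans x y z)
  then show ?case using related_F[OF trans(1)] related_trans by metis
qed

section \<open>The arrows of the constructed category\<close>

abbreviation arrow :: "'xo \<Rightarrow> 'ma \<Rightarrow> 'xo \<Rightarrow> bool" where
  "arrow x1 \<mu> x2 \<equiv> bar_arrow A X F M G P cF cP x1 \<mu> x2"

abbreviation cls :: "'xo \<Rightarrow> 'xo set" where
  "cls x \<equiv> vclass X M P x"

lemma cls_eq_iff: "x \<in> Obj X \<Longrightarrow> y \<in> Obj X \<Longrightarrow> cls x = cls y \<longleftrightarrow> x \<approx> y"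
  unfolding vclass_def using eq_equiv_class_iff[OF related_equiv] by blast

text \<open>The definition without the description operator: the vertical part of \<open>\<mu>\<close> exists and is
  unique because \<open>P\<close> preserves cartesian arrows.\<close>

lemma arrow_iff:
  assumes x1: "x1 \<in> Obj X" and x2: "x2 \<in> Obj X"
  shows "arrow x1 \<mu> x2 \<longleftrightarrow> \<mu> \<in> hom M (OMap P x1) (OMap P x2) \<and>
    (\<exists>\<beta>\<in>hom M (OMap P x1) (OMap P (pull (AMap G \<mu>) x2)).
       AMap P (cF (AMap G \<mu>) x2) \<cdot>\<^bsub>M\<^esub> \<beta> = \<mu> \<and> AMap G \<beta> = Ident A (OMap F x1) \<and>
       push \<beta> x1 \<approx> pull (AMap G \<mu>) x2)"
proof (cases "\<mu> \<in> hom M (OMap P x1) (OMap P x2)")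
  case True
  let ?\<alpha> = "AMap G \<mu>"
  let ?p = "pull ?\<alpha> x2" and ?c = "cF ?\<alpha> x2"
  have \<alpha>: "?\<alpha> \<in> hom A (OMap F x1) (OMap F x2)" using G.map_hom[OF True] GP_obj x1 x2 by simp
  note c = pull[OF x2 \<alpha>]
  let ?B = "\<lambda>\<beta>. \<beta> \<in> hom M (OMap P x1) (OMap P ?p) \<and> AMap P ?c \<cdot>\<^bsub>M\<^esub> \<beta> = \<mu> \<and>
      AMap G \<beta> = Ident A (OMap F x1)"
  have "Ident A (OMap F x1) \<in> hom A (OMap G (OMap P x1)) (OMap G (OMap P ?p))"
    using F.cod.ident_hom F.map_obj x1 GP_obj c(4,5) by simp
  moreover have "AMap G (AMap P ?c) \<cdot>\<^bsub>A\<^esub> Ident A (OMap F x1) = ?\<alpha>"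
    using GP_hom[OF c(2)] c(3) F.cod.hom_ident(1)[OF \<alpha>] by simp
  ultimately have "\<exists>!\<beta>. ?B \<beta>"
    using G.cartesian_ex1[OF P_cartesian[OF c(1)] P.map_hom[OF c(2)] True] by metis
  then obtain \<beta> where \<beta>: "?B \<beta>" and u: "\<And>\<beta>'. ?B \<beta>' \<Longrightarrow> \<beta>' = \<beta>" by blast
  have the: "(THE \<beta>. ?B \<beta>) = \<beta>" using \<beta> u by (rule the_equality)
  have "push \<beta> x1 \<in> Obj X" using push(4)[OF x1] \<beta> by blast
  then have "arrow x1 \<mu> x2 \<longleftrightarrow> push \<beta> x1 \<approx> ?p"
    unfolding bar_arrow_def Let_def pull_def[symmetric] the
    using True cls_eq_iff c(4) by (simp add: push_def)
  then show ?thesis using True \<beta> u by blast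
qed (simp add: bar_arrow_def)

text \<open>Both \<open>P\<close> and \<open>F\<close> are constant on classes, so the vertical part of \<open>\<mu>\<close> is the same for all
  representatives, and its pushforward and the pullback only move within their classes.\<close>

lemma arrow_related:
  assumes "arrow x1 \<mu> x2" "x1 \<approx> y1" "x2 \<approx> y2"
  shows "arrow y1 \<mu> y2"
proof -
  have objs: "x1 \<in> Obj X" "x2 \<in> Obj X" "y1 \<in> Obj X" "y2 \<in> Obj X"
    using related_obj assms(2,3) by auto
  let ?\<alpha> = "AMap G \<mu>"
  obtain \<beta> where \<mu>: "\<mu> \<in> hom M (OMap P x1) (OMap P x2)"
    and \<beta>: "\<beta> \<in> hom M (OMap P x1) (OMap P (pull ?\<alpha> x2))" "AMap P (cF ?\<alpha> x2) \<cdot>\<^bsub>M\<^esub> \<beta> = \<mu>"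
      "AMap G \<beta> = Ident A (OMap F x1)" "push \<beta> x1 \<approx> pull ?\<alpha> x2"
    using assms(1) arrow_iff[OF objs(1,2)] by blast
  have \<alpha>: "?\<alpha> \<in> hom A (OMap F x1) (OMap F x2)" using G.map_hom[OF \<mu>] GP_obj objs by simp
  have pp: "pull ?\<alpha> x2 \<approx> pull ?\<alpha> y2" using pull_related[OF assms(3) \<alpha>] .
  have "AMap P (cF ?\<alpha> y2) = AMap P (cF ?\<alpha> x2)"
    using pull(6)[OF objs(2) \<alpha>] pull(6)[OF objs(4), of ?\<alpha>] \<alpha> related_F[OF assms(3)]
      related_P[OF assms(3)] by simp
  moreover have "push \<beta> y1 \<approx> pull ?\<alpha> y2"
    using related_trans[OF related_sym[OF push_related[OF assms(2) \<beta>(1,3)]] related_trans[OF \<beta>(4) pp]] .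
  ultimately show ?thesis
    using arrow_iff[OF objs(3,4)] \<mu> \<beta> related_P[OF assms(2)] related_P[OF assms(3)]
      related_F[OF assms(2)] related_P[OF pp] by auto
qed

lemma arrow_hom: "arrow x1 \<mu> x2 \<Longrightarrow> \<mu> \<in> hom M (OMap P x1) (OMap P x2)"
  by (simp add: bar_arrow_def)

lemma arrowE:
  assumes "arrow x1 \<mu> x2" "x1 \<in> Obj X" "x2 \<in> Obj X"
  obtains u y where "u \<in> hom X x1 y" "AMap F u = Ident A (OMap F x1)"
    "y \<approx> pull (AMap G \<mu>) x2" "AMap P (cF (AMap G \<mu>) x2) \<cdot>\<^bsub>M\<^esub> AMap P u = \<mu>"
    "AMap G \<mu> \<in> hom A (OMap F x1) (OMap F x2)"
proof -
  obtain \<beta> where \<mu>: "\<mu> \<in> hom M (OMap P x1) (OMap P x2)"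
    and \<beta>: "\<beta> \<in> hom M (OMap P x1) (OMap P (pull (AMap G \<mu>) x2))"
      "AMap P (cF (AMap G \<mu>) x2) \<cdot>\<^bsub>M\<^esub> \<beta> = \<mu>"
      "AMap G \<beta> = Ident A (OMap F x1)" "push \<beta> x1 \<approx> pull (AMap G \<mu>) x2"
    using assms(1) arrow_iff[OF assms(2,3)] by blast
  have "AMap G \<mu> \<in> hom A (OMap F x1) (OMap F x2)" using G.map_hom[OF \<mu>] GP_obj assms by simp
  then show thesis using that push[OF assms(2) \<beta>(1,3)] \<beta>(2,4) by metis
qed

text \<open>The converse of \<open>arrowE\<close> for an arbitrary second factor. Splitting \<open>f\<close> into the chosen lifting
  and a vertical arrow \<open>f'\<close> gives the vertical part \<open>P f' \<cdot> P u\<close>; the pushforward along it is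
  computed by first applying \<open>u\<close>, then moving along \<open>y \<approx> y'\<close>, and then applying \<open>f'\<close>.\<close>

lemma arrowI:
  assumes u: "u \<in> hom X x1 y" "AMap F u = Ident A (OMap F x1)"
    and yy': "y \<approx> y'" and f: "f \<in> hom X y' x2"
  shows "arrow x1 (AMap P f \<cdot>\<^bsub>M\<^esub> AMap P u) x2"
proof -
  have x1: "x1 \<in> Obj X" and x2: "x2 \<in> Obj X" and y: "y \<in> Obj X" and y': "y' \<in> Obj X"
    using hom_objs u f by auto
  let ?\<alpha> = "AMap F f" and ?\<mu> = "AMap P f \<cdot>\<^bsub>M\<^esub> AMap P u"
  have Fy: "OMap F y = OMap F x1"
    using F.map_hom[OF u(1)] u(2) F.cod.ident_hom[OF F.map_obj[OF x1]] by (auto simp: hom_def)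
  have Fy': "OMap F y' = OMap F x1" using Fy related_F[OF yy'] by simp
  have Pu: "AMap P u \<in> hom M (OMap P x1) (OMap P y')" using P.map_hom[OF u(1)] related_P[OF yy'] by simp
  note Pf = P.map_hom[OF f]
  have \<alpha>: "?\<alpha> \<in> hom A (OMap F x1) (OMap F x2)" using F.map_hom[OF f] Fy' by simp
  have \<mu>: "?\<mu> \<in> hom M (OMap P x1) (OMap P x2)" using G.dom.comp_hom[OF Pu Pf] .
  have G\<mu>: "AMap G ?\<mu> = ?\<alpha>"
    using G.map_comp[OF Pu Pf] GP_hom[OF f] GP_hom[OF u(1)] u(2) F.cod.hom_ident(1)[OF \<alpha>] by simp
  note c = pull[OF x2 \<alpha>]
  obtain f' where f': "f' \<in> hom X y' (pull ?\<alpha> x2)" "AMap F f' = Ident A (OMap F x1)"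
      "cF ?\<alpha> x2 \<cdot>\<^bsub>X\<^esub> f' = f"
    using F.cartesian_factor[OF c(1,2) f c(3)[symmetric]] Fy' by metis
  note Pf' = P.map_hom[OF f'(1)]
  let ?\<beta> = "AMap P f' \<cdot>\<^bsub>M\<^esub> AMap P u"
  have Gf': "AMap G (AMap P f') = Ident A (OMap F y)" using GP_hom[OF f'(1)] f'(2) Fy by simp
  have Pf'y: "AMap P f' \<in> hom M (OMap P y) (OMap P (pull ?\<alpha> x2))" using Pf' related_P[OF yy'] by simp
  note w = push[OF y Pf'y Gf']
  have II: "Ident A (OMap F x1) \<cdot>\<^bsub>A\<^esub> Ident A (OMap F x1) = Ident A (OMap F x1)"
    using F.cod.hom_ident(1)[OF F.cod.ident_hom[OF F.map_obj[OF x1]]] .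
  have "push (AMap P (cP (AMap P f') y \<cdot>\<^bsub>X\<^esub> u)) x1 \<approx> push (AMap P f') y"
    using vertical_related_push[OF F.dom.comp_hom[OF u(1) w(1)]] F.map_comp[OF u(1) w(1)]
      u(2) w(2) Fy II by simp
  then have "push ?\<beta> x1 \<approx> push (AMap P f') y" using P.map_comp[OF u(1) w(1)] w(3) by simp
  also have "push (AMap P f') y \<approx> push (AMap P f') y'" using push_related[OF yy' Pf'y Gf'] .
  also have "push (AMap P f') y' \<approx> pull ?\<alpha> x2"
    using vertical_related_push[OF f'(1)] f'(2) Fy' by simp
  finally have "push ?\<beta> x1 \<approx> pull ?\<alpha> x2" .
  moreover have "AMap P (cF ?\<alpha> x2) \<cdot>\<^bsub>M\<^esub> ?\<beta> = ?\<mu>"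
    using G.dom.comp_assoc[OF Pu Pf' P.map_hom[OF c(2)]] P.map_comp[OF f'(1) c(2)] f'(3) by simp
  moreover have "AMap G ?\<beta> = Ident A (OMap F x1)"
    using G.map_comp[OF Pu Pf'] GP_hom[OF f'(1)] GP_hom[OF u(1)] u(2) f'(2) II by simp
  ultimately show ?thesis
    using arrow_iff[OF x1 x2] \<mu> G\<mu> G.dom.comp_hom[OF Pu Pf'] by auto
qed

lemma arrow_of_arr:
  assumes "f \<in> hom X x y"
  shows "arrow x (AMap P f) y"
proof -
  have x: "x \<in> Obj X" using hom_objs assms by auto
  show ?thesis
    using arrowI[OF F.dom.ident_hom[OF x] F.map_ident[OF x] related_refl[OF x] assms]
      P.map_ident[OF x] G.dom.hom_ident(1)[OF P.map_hom[OF assms]] by simp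
qed

text \<open>With \<open>\<mu> = P (cF \<alpha> x2) \<cdot> P u\<close> and \<open>\<nu> = P (cF \<alpha>' x3) \<cdot> P u'\<close>, the two middle factors have to be
  exchanged. The vertical arrow \<open>u'\<close> restricts along \<open>\<alpha>\<close> to \<open>v\<close>, with \<open>cF \<alpha> y' \<cdot> v = u' \<cdot> cF \<alpha> x2\<close>.
  Since \<open>v\<close> starts at \<open>pull \<alpha> x2\<close> and \<open>u\<close> ends at \<open>y \<approx> pull \<alpha> x2\<close>, the arrow \<open>v\<close> is replaced by
  the opcartesian lifting \<open>w\<close> of \<open>P v\<close> at \<open>y\<close>, which composes with \<open>u\<close> and has the same image
  under \<open>P\<close>. Likewise \<open>cF \<alpha> y'\<close> is replaced by the lifting of \<open>\<alpha>\<close> at \<open>pull \<alpha>' x3\<close>. The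
  canonical comparison between pushing forward and pulling back is \<open>P\<close>-vertical, hence invisible
  to \<open>\<approx>\<close>.\<close>

lemma arrow_comp:
  assumes \<mu>: "arrow x1 \<mu> x2" and \<nu>: "arrow x2 \<nu> x3"
    and objs: "x1 \<in> Obj X" "x2 \<in> Obj X" "x3 \<in> Obj X"
  shows "arrow x1 (\<nu> \<cdot>\<^bsub>M\<^esub> \<mu>) x3"
proof -
  define \<alpha> \<alpha>' where "\<alpha> = AMap G \<mu>" and "\<alpha>' = AMap G \<nu>"
  obtain u y where u: "u \<in> hom X x1 y" "AMap F u = Ident A (OMap F x1)" "y \<approx> pull \<alpha> x2"
    "AMap P (cF \<alpha> x2) \<cdot>\<^bsub>M\<^esub> AMap P u = \<mu>" "\<alpha> \<in> hom A (OMap F x1) (OMap F x2)"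
    unfolding \<alpha>_def by (rule arrowE[OF \<mu> objs(1,2)])
  obtain u' y' where u': "u' \<in> hom X x2 y'" "AMap F u' = Ident A (OMap F x2)" "y' \<approx> pull \<alpha>' x3"
    "AMap P (cF \<alpha>' x3) \<cdot>\<^bsub>M\<^esub> AMap P u' = \<nu>" "\<alpha>' \<in> hom A (OMap F x2) (OMap F x3)"
    unfolding \<alpha>'_def by (rule arrowE[OF \<nu> objs(2,3)])
  let ?q = "pull \<alpha>' x3"
  have y: "y \<in> Obj X" and y': "y' \<in> Obj X" using hom_objs u u' by auto
  note c = pull[OF objs(2) u(5)] and c' = pull[OF objs(3) u'(5)]
  have Fy': "OMap F y' = OMap F x2" using related_F[OF u'(3)] c'(5) by simp
  have Fy: "OMap F y = OMap F x1" using related_F[OF u(3)] c(5) by simp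
  have \<alpha>y': "\<alpha> \<in> hom A (OMap F x1) (OMap F y')" and \<alpha>q: "\<alpha> \<in> hom A (OMap F x1) (OMap F ?q)"
    using u(5) Fy' c'(5) by auto
  note d = pull[OF y' \<alpha>y'] and d' = pull[OF c'(4) \<alpha>q]
  have "AMap F (u' \<cdot>\<^bsub>X\<^esub> cF \<alpha> x2) = AMap F (cF \<alpha> y')"
    using F.map_comp[OF c(2) u'(1)] u'(2) c(3) d(3) F.cod.hom_ident(2)[OF u(5)] by simp
  then obtain v where v: "v \<in> hom X (pull \<alpha> x2) (pull \<alpha> y')" "AMap F v = Ident A (OMap F x1)"
      "cF \<alpha> y' \<cdot>\<^bsub>X\<^esub> v = u' \<cdot>\<^bsub>X\<^esub> cF \<alpha> x2"
    using F.cartesian_factor[OF d(1,2) F.dom.comp_hom[OF c(2) u'(1)]] c(5) by metis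
  have Pv: "AMap P v \<in> hom M (OMap P y) (OMap P (pull \<alpha> y'))" using P.map_hom[OF v(1)] related_P[OF u(3)] by simp
  have Gv: "AMap G (AMap P v) = Ident A (OMap F y)" using GP_hom[OF v(1)] v(2) Fy by simp
  note w = push[OF y Pv Gv]
  let ?w = "cP (AMap P v) y" and ?z = "push (AMap P v) y"
  have "?z \<approx> push (AMap P v) (pull \<alpha> x2)" using push_related[OF u(3) Pv Gv] .
  also have "push (AMap P v) (pull \<alpha> x2) \<approx> pull \<alpha> y'" using vertical_related_push[OF v(1)] v(2) c(5) by simp
  also have "pull \<alpha> y' \<approx> pull \<alpha> ?q" using pull_related[OF u'(3) \<alpha>y'] .
  finally have z: "?z \<approx> pull \<alpha> ?q" .
  have wu: "?w \<cdot>\<^bsub>X\<^esub> u \<in> hom X x1 ?z" using F.dom.comp_hom[OF u(1) w(1)] .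
  have Fwu: "AMap F (?w \<cdot>\<^bsub>X\<^esub> u) = Ident A (OMap F x1)"
    using F.map_comp[OF u(1) w(1)] u(2) w(2) Fy
      F.cod.hom_ident(1)[OF F.cod.ident_hom[OF F.map_obj[OF objs(1)]]]
    by simp
  have f: "cF \<alpha>' x3 \<cdot>\<^bsub>X\<^esub> cF \<alpha> ?q \<in> hom X (pull \<alpha> ?q) x3" using F.dom.comp_hom[OF d'(2) c'(2)] .
  have Pd: "AMap P (cF \<alpha> ?q) = AMap P (cF \<alpha> y')" using d(6) d'(6) related_P[OF u'(3)] by simp
  have hs: "AMap P u \<in> hom M (OMap P x1) (OMap P (pull \<alpha> x2))"
    "AMap P v \<in> hom M (OMap P (pull \<alpha> x2)) (OMap P (pull \<alpha> y'))"
    "AMap P (cF \<alpha> y') \<in> hom M (OMap P (pull \<alpha> y')) (OMap P ?q)"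
    "AMap P (cF \<alpha>' x3) \<in> hom M (OMap P ?q) (OMap P x3)"
    "AMap P (cF \<alpha> x2) \<in> hom M (OMap P (pull \<alpha> x2)) (OMap P x2)"
    "AMap P u' \<in> hom M (OMap P x2) (OMap P ?q)"
    using P.map_hom[OF u(1)] P.map_hom[OF v(1)] P.map_hom[OF d(2)] P.map_hom[OF c'(2)]
      P.map_hom[OF c(2)] P.map_hom[OF u'(1)] related_P[OF u(3)] related_P[OF u'(3)] by auto
  have "AMap P (cF \<alpha>' x3 \<cdot>\<^bsub>X\<^esub> cF \<alpha> ?q) \<cdot>\<^bsub>M\<^esub> AMap P (?w \<cdot>\<^bsub>X\<^esub> u)
      = (AMap P (cF \<alpha>' x3) \<cdot>\<^bsub>M\<^esub> AMap P (cF \<alpha> y')) \<cdot>\<^bsub>M\<^esub> (AMap P v \<cdot>\<^bsub>M\<^esub> AMap P u)"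
    using P.map_comp[OF d'(2) c'(2)] Pd P.map_comp[OF u(1) w(1)] w(3) by simp
  also have "\<dots> = AMap P (cF \<alpha>' x3) \<cdot>\<^bsub>M\<^esub> ((AMap P (cF \<alpha> y') \<cdot>\<^bsub>M\<^esub> AMap P v) \<cdot>\<^bsub>M\<^esub> AMap P u)"
    using G.dom.comp_assoc[OF G.dom.comp_hom[OF hs(1,2)] hs(3,4)] G.dom.comp_assoc[OF hs(1-3)] by simp
  also have "AMap P (cF \<alpha> y') \<cdot>\<^bsub>M\<^esub> AMap P v = AMap P u' \<cdot>\<^bsub>M\<^esub> AMap P (cF \<alpha> x2)"
    using P.map_comp[OF v(1) d(2)] P.map_comp[OF c(2) u'(1)] v(3) by simp
  also have "(AMap P u' \<cdot>\<^bsub>M\<^esub> AMap P (cF \<alpha> x2)) \<cdot>\<^bsub>M\<^esub> AMap P u = AMap P u' \<cdot>\<^bsub>M\<^esub> \<mu>"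
    using G.dom.comp_assoc[OF hs(1,5,6)] u(4) by simp
  also have "AMap P (cF \<alpha>' x3) \<cdot>\<^bsub>M\<^esub> (AMap P u' \<cdot>\<^bsub>M\<^esub> \<mu>) = \<nu> \<cdot>\<^bsub>M\<^esub> \<mu>"
    using G.dom.comp_assoc[OF arrow_hom[OF \<mu>] hs(6,4)] u'(4) by simp
  finally show ?thesis using arrowI[OF wu Fwu z f] by simp
qed

section \<open>The constructed category as a fibration\<close>

abbreviation bar :: "('xo set, 'xo set \<times> 'ma \<times> 'xo set) cat" where
  "bar \<equiv> bar_cat A X F M G P cF cP"

abbreviation barF :: "('xo set, 'xo set \<times> 'ma \<times> 'xo set, 'p, 'b) func" where
  "barF \<equiv> bar_proj F G"

abbreviation Q :: "('xo, 'xa, 'xo set, 'xo set \<times> 'ma \<times> 'xo set) func" where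
  "Q \<equiv> bar_Q X M P"

lemma cls_obj: "x \<in> Obj X \<Longrightarrow> cls x \<in> Obj bar"
  by (simp add: bar_cat_def vclass_def quotientI)

lemma bar_objE:
  assumes "U \<in> Obj bar"
  obtains x where "x \<in> Obj X" "U = cls x"
  using assms by (auto simp: bar_cat_def vclass_def elim: quotientE)

lemma mem_cls_iff: "y \<in> cls x \<longleftrightarrow> x \<approx> y"
  by (simp add: vclass_def)

lemma cls_self: "x \<in> Obj X \<Longrightarrow> x \<in> cls x"
  using mem_cls_iff related_refl by simp

lemma the_elem_cls:
  assumes "x \<in> Obj X"
  shows "the_elem (OMap P ` cls x) = OMap P x" "the_elem (OMap F ` cls x) = OMap F x"
proof -
  have "OMap P y = OMap P x \<and> OMap F y = OMap F x" if "y \<in> cls x" for y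
    using that related_P[of x y] related_F[of x y] by (simp add: mem_cls_iff)
  then have "OMap P ` cls x = {OMap P x}" "OMap F ` cls x = {OMap F x}"
    using cls_self[OF assms] by blast+
  then show "the_elem (OMap P ` cls x) = OMap P x" "the_elem (OMap F ` cls x) = OMap F x" by auto
qed

text \<open>The definition asks for some representatives of the two classes; by \<open>arrow_related\<close> any
  prescribed ones will do.\<close>

lemma bar_hom_cls_iff:
  assumes "x \<in> Obj X" "y \<in> Obj X"
  shows "t \<in> hom bar (cls x) (cls y) \<longleftrightarrow> (\<exists>\<mu>. t = (cls x, \<mu>, cls y) \<and> arrow x \<mu> y)"
proof
  assume "t \<in> hom bar (cls x) (cls y)"
  then obtain \<mu> x' y' where "t = (cls x, \<mu>, cls y)" "x' \<in> cls x" "y' \<in> cls y" "arrow x' \<mu> y'"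
    by (auto simp: hom_def bar_cat_def)
  then show "\<exists>\<mu>. t = (cls x, \<mu>, cls y) \<and> arrow x \<mu> y"
    using arrow_related related_sym by (auto simp: mem_cls_iff)
next
  assume "\<exists>\<mu>. t = (cls x, \<mu>, cls y) \<and> arrow x \<mu> y"
  then show "t \<in> hom bar (cls x) (cls y)"
    using cls_obj cls_self assms by (auto simp: hom_def bar_cat_def)
qed

lemma bar_homE:
  assumes "t \<in> hom bar U V"
  obtains x \<mu> y where "x \<in> Obj X" "y \<in> Obj X" "U = cls x" "V = cls y"
    "t = (cls x, \<mu>, cls y)" "arrow x \<mu> y"
proof -
  have "U \<in> Obj bar" "V \<in> Obj bar" using assms by (auto simp: hom_def bar_cat_def)
  then obtain x y where "x \<in> Obj X" "y \<in> Obj X" "U = cls x" "V = cls y" by (metis bar_objE)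
  with assms that bar_hom_cls_iff show thesis by metis
qed

lemma bar_comp: "(V', \<nu>, W) \<cdot>\<^bsub>bar\<^esub> (U, \<mu>, V) = (U, \<nu> \<cdot>\<^bsub>M\<^esub> \<mu>, W)"
  by (simp add: bar_cat_def)

lemma bar_ident: "x \<in> Obj X \<Longrightarrow> Ident bar (cls x) = (cls x, Ident M (OMap P x), cls x)"
  using the_elem_cls by (simp add: bar_cat_def)

lemma bar_arr_hom: "t \<in> Arr bar \<Longrightarrow> t \<in> hom bar (Dom bar t) (Cod bar t)"
  by (simp add: hom_def)

lemma bar_category: "category bar"
proof
  show "Dom bar f \<in> Obj bar" "Cod bar f \<in> Obj bar" if "f \<in> Arr bar" for f
    using that by (auto simp: bar_cat_def)
next
  fix U assume "U \<in> Obj bar"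
  then obtain x where x: "x \<in> Obj X" "U = cls x" by (rule bar_objE)
  have "arrow x (Ident M (OMap P x)) x"
    using arrow_of_arr[OF F.dom.ident_hom[OF x(1)]] P.map_ident[OF x(1)] by simp
  then show "Ident bar U \<in> hom bar U U" using bar_hom_cls_iff bar_ident x by auto
next
  fix f g U V W assume f: "f \<in> hom bar U V" and g: "g \<in> hom bar V W"
  obtain x \<mu> y where f': "x \<in> Obj X" "y \<in> Obj X" "U = cls x" "V = cls y" "f = (cls x, \<mu>, cls y)"
    "arrow x \<mu> y" using f by (rule bar_homE)
  obtain z where z: "z \<in> Obj X" "W = cls z" using g by (rule bar_homE)
  obtain \<nu> where g': "g = (cls y, \<nu>, cls z)" "arrow y \<nu> z"
    using g bar_hom_cls_iff[OF f'(2) z(1)] f' z by auto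
  show "g \<cdot>\<^bsub>bar\<^esub> f \<in> hom bar U W"
    using arrow_comp[OF f'(6) g'(2)] f' z g' bar_hom_cls_iff bar_comp by auto
next
  fix f assume "f \<in> Arr bar"
  then obtain x \<mu> y where f: "x \<in> Obj X" "y \<in> Obj X" "Dom bar f = cls x" "Cod bar f = cls y"
    "f = (cls x, \<mu>, cls y)" "arrow x \<mu> y" using bar_arr_hom bar_homE by metis
  show "f \<cdot>\<^bsub>bar\<^esub> Ident bar (Dom bar f) = f" "Ident bar (Cod bar f) \<cdot>\<^bsub>bar\<^esub> f = f"
    using f bar_ident bar_comp G.dom.hom_ident[OF arrow_hom[OF f(6)]] by auto
next
  fix f g h U V W Z assume f: "f \<in> hom bar U V" and g: "g \<in> hom bar V W" and h: "h \<in> hom bar W Z"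
  obtain x \<mu> y where f': "x \<in> Obj X" "y \<in> Obj X" "U = cls x" "V = cls y" "f = (cls x, \<mu>, cls y)"
    "arrow x \<mu> y" using f by (rule bar_homE)
  obtain z \<omega> w where h': "z \<in> Obj X" "w \<in> Obj X" "W = cls z" "Z = cls w" "h = (cls z, \<omega>, cls w)"
    "arrow z \<omega> w" using h by (rule bar_homE)
  obtain \<nu> where g': "g = (cls y, \<nu>, cls z)" "arrow y \<nu> z"
    using g bar_hom_cls_iff[OF f'(2) h'(1)] f' h' by auto
  show "(h \<cdot>\<^bsub>bar\<^esub> g) \<cdot>\<^bsub>bar\<^esub> f = h \<cdot>\<^bsub>bar\<^esub> (g \<cdot>\<^bsub>bar\<^esub> f)"
    using f' g' h' bar_comp
      G.dom.comp_assoc[OF arrow_hom[OF f'(6)] arrow_hom[OF g'(2)] arrow_hom[OF h'(6)]] by simp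
qed

lemma barF_functor: "is_functor bar A barF"
proof (intro is_functor.intro is_functor_axioms.intro)
  show "category bar" by (rule bar_category)
  show "category A" by (rule F.cod.category_axioms)
next
  fix U assume "U \<in> Obj bar"
  then obtain x where x: "x \<in> Obj X" "U = cls x" by (rule bar_objE)
  show "OMap barF U \<in> Obj A" using x F.map_obj the_elem_cls by (simp add: bar_proj_def)
  show "AMap barF (Ident bar U) = Ident A (OMap barF U)"
    using x bar_ident the_elem_cls G.map_ident[OF P.map_obj] GP_obj by (simp add: bar_proj_def)
next
  fix f U V assume "f \<in> hom bar U V"
  then obtain x \<mu> y where f: "x \<in> Obj X" "y \<in> Obj X" "U = cls x" "V = cls y" "f = (cls x, \<mu>, cls y)"
    "arrow x \<mu> y" by (rule bar_homE)
  show "AMap barF f \<in> hom A (OMap barF U) (OMap barF V)"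
    using f the_elem_cls G.map_hom[OF arrow_hom[OF f(6)]] GP_obj by (simp add: bar_proj_def)
next
  fix f g U V W assume f: "f \<in> hom bar U V" and g: "g \<in> hom bar V W"
  obtain x \<mu> y where f': "x \<in> Obj X" "y \<in> Obj X" "U = cls x" "V = cls y" "f = (cls x, \<mu>, cls y)"
    "arrow x \<mu> y" using f by (rule bar_homE)
  obtain z where z: "z \<in> Obj X" "W = cls z" using g by (rule bar_homE)
  obtain \<nu> where g': "g = (cls y, \<nu>, cls z)" "arrow y \<nu> z"
    using g bar_hom_cls_iff[OF f'(2) z(1)] f' z by auto
  show "AMap barF (g \<cdot>\<^bsub>bar\<^esub> f) = AMap barF g \<cdot>\<^bsub>A\<^esub> AMap barF f"
    using f' g' bar_comp G.map_comp[OF arrow_hom[OF f'(6)] arrow_hom[OF g'(2)]]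
    by (simp add: bar_proj_def)
qed

lemma AMap_Q: "f \<in> hom X x y \<Longrightarrow> AMap Q f = (cls x, AMap P f, cls y)"
  by (simp add: bar_Q_def hom_def)

lemma Q_functor: "is_functor X bar Q"
proof (intro is_functor.intro is_functor_axioms.intro)
  show "category X" by (rule F.dom.category_axioms)
  show "category bar" by (rule bar_category)
next
  fix x assume x: "x \<in> Obj X"
  show "OMap Q x \<in> Obj bar" using x cls_obj by (simp add: bar_Q_def)
  show "AMap Q (Ident X x) = Ident bar (OMap Q x)"
    using x bar_ident P.map_ident F.dom.ident_hom[OF x] by (simp add: bar_Q_def hom_def)
next
  fix f x y assume f: "f \<in> hom X x y"
  then have "(cls x, AMap P f, cls y) \<in> hom bar (cls x) (cls y)"
    using arrow_of_arr[OF f] bar_hom_cls_iff hom_objs by blast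
  then show "AMap Q f \<in> hom bar (OMap Q x) (OMap Q y)"
    using AMap_Q[OF f] by (simp add: bar_Q_def)
next
  fix f g x y z assume f: "f \<in> hom X x y" and g: "g \<in> hom X y z"
  then show "AMap Q (g \<cdot>\<^bsub>X\<^esub> f) = AMap Q g \<cdot>\<^bsub>bar\<^esub> AMap Q f"
    using F.dom.comp_hom[OF f g] P.map_comp[OF f g] bar_comp by (simp add: bar_Q_def hom_def)
qed

lemma barF_Q: "func_eq X (barF \<odot> Q) F"
  using the_elem_cls GP_arr by (auto simp: func_eq_def func_comp_def bar_proj_def bar_Q_def)

text \<open>Let \<open>\<nu>\<close> be an arrow into the class of \<open>x\<close> whose image in \<open>A\<close> is \<open>\<alpha> \<cdot> \<gamma>\<close>. Its factor over
  \<open>\<gamma>\<close> exists and is unique in \<open>M\<close>, and the point is that it is an arrow of the quotient. Since the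
  cleavage of \<open>G\<close> is functorial, the composite of the chosen liftings of \<open>\<gamma>\<close> and \<open>\<alpha>\<close> has the same
  image in \<open>M\<close> as the chosen lifting of \<open>\<alpha> \<cdot> \<gamma>\<close>; so pulling back along \<open>\<alpha> \<cdot> \<gamma>\<close> agrees up to \<open>\<approx>\<close>
  with pulling back in two stages, and the vertical part of \<open>\<nu>\<close> is also the vertical part of the
  factor.\<close>

lemma Q_pull_cartesian:
  assumes x: "x \<in> Obj X" and \<alpha>: "\<alpha> \<in> hom A a (OMap F x)"
  shows "cartesian bar A barF (AMap Q (cF \<alpha> x))"
proof -
  interpret barF: is_functor bar A barF by (rule barF_functor)
  interpret Q: is_functor X bar Q by (rule Q_functor)
  note c = pull[OF x \<alpha>]
  let ?p = "pull \<alpha> x"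
  have QC: "AMap Q (cF \<alpha> x) \<in> hom bar (cls ?p) (cls x)"
    using Q.map_hom[OF c(2)] by (simp add: bar_Q_def)
  note PC = P.map_hom[OF c(2)]
  show ?thesis
  proof (rule barF.cartesianI[OF QC])
    fix W t \<gamma>
    assume t: "t \<in> hom bar W (cls x)" and \<gamma>: "\<gamma> \<in> hom A (OMap barF W) (OMap barF (cls ?p))"
      and eq: "AMap barF (AMap Q (cF \<alpha> x)) \<cdot>\<^bsub>A\<^esub> \<gamma> = AMap barF t"
    obtain w where w: "w \<in> Obj X" "W = cls w" using t by (rule bar_homE)
    obtain \<nu> where t': "t = (cls w, \<nu>, cls x)" and \<nu>: "arrow w \<nu> x"
      using t bar_hom_cls_iff[OF w(1) x] w(2) by auto
    have \<gamma>h: "\<gamma> \<in> hom A (OMap F w) (OMap F ?p)"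
      using \<gamma> the_elem_cls w c(4) by (simp add: bar_proj_def)
    have G\<nu>: "\<alpha> \<cdot>\<^bsub>A\<^esub> \<gamma> = AMap G \<nu>"
      using eq t' AMap_Q[OF c(2)] GP_hom[OF c(2)] c(3) by (simp add: bar_proj_def)
    have \<gamma>G: "\<gamma> \<in> hom A (OMap G (OMap P w)) (OMap G (OMap P ?p))" using \<gamma>h GP_obj w c(4) by simp
    have "AMap G (AMap P (cF \<alpha> x)) \<cdot>\<^bsub>A\<^esub> \<gamma> = AMap G \<nu>" using G\<nu> GP_hom[OF c(2)] c(3) by simp
    note ex1 = G.cartesian_ex1[OF P_cartesian[OF c(1)] PC arrow_hom[OF \<nu>] \<gamma>G this]
    obtain u y where u: "u \<in> hom X w y" "AMap F u = Ident A (OMap F w)"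
      "y \<approx> pull (AMap G \<nu>) x" "AMap P (cF (AMap G \<nu>) x) \<cdot>\<^bsub>M\<^esub> AMap P u = \<nu>"
      using arrowE[OF \<nu> w(1) x] by metis
    have G\<nu>h: "AMap G \<nu> \<in> hom A (OMap F w) (OMap F x)"
      using G.map_hom[OF arrow_hom[OF \<nu>]] GP_obj w x by simp
    note e = pull[OF x G\<nu>h] and d = pull[OF c(4) \<gamma>h]
    let ?q = "pull \<gamma> ?p"
    have \<gamma>a: "\<alpha> \<in> hom A (OMap F ?p) (OMap F x)" using \<alpha> c(5) by simp
    have k: "cF \<alpha> x \<cdot>\<^bsub>X\<^esub> cF \<gamma> ?p \<in> hom X ?q x" using F.dom.comp_hom[OF d(2) c(2)] .
    have Fk: "AMap F (cF \<alpha> x \<cdot>\<^bsub>X\<^esub> cF \<gamma> ?p) = AMap G \<nu>"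
      using F.map_comp[OF d(2) c(2)] c(3) d(3) G\<nu> by simp
    have Pk: "AMap P (cF \<alpha> x \<cdot>\<^bsub>X\<^esub> cF \<gamma> ?p) = AMap P (cF (AMap G \<nu>) x)"
    proof -
      have fc: "functorial_cleavage M A G cG" using choices by (simp add: construction_choices_def)
      have "OMap P ?p = Dom M (cG \<alpha> (OMap P x))" using PC c(6) by (simp add: hom_def)
      moreover have "\<gamma> \<in> Arr A \<and> \<alpha> \<in> Arr A \<and> Cod A \<alpha> = OMap G (OMap P x) \<and> Cod A \<gamma> = Dom A \<alpha>"
        using \<gamma>h \<gamma>a GP_obj x by (simp add: hom_def)
      ultimately have "cG (\<alpha> \<cdot>\<^bsub>A\<^esub> \<gamma>) (OMap P x) = cG \<alpha> (OMap P x) \<cdot>\<^bsub>M\<^esub> cG \<gamma> (OMap P ?p)"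
        using fc P.map_obj[OF x] by (simp add: functorial_cleavage_def)
      then show ?thesis using P.map_comp[OF d(2) c(2)] c(6) d(6) e(6) G\<nu> by simp
    qed
    \<comment> \<open>Pullback in two stages agrees with pullback along the composite.\<close>
    have "?q \<approx> pull (AMap G \<nu>) x"
      using chosen_image_related_pull[OF k] Fk Pk e(6) by simp
    then have yq: "y \<approx> ?q" using u(3) related_trans related_sym by blast
    have Pu: "AMap P u \<in> hom M (OMap P w) (OMap P ?q)"
      using P.map_hom[OF u(1)] related_P[OF yq] by simp
    define \<mu> where "\<mu> = AMap P (cF \<gamma> ?p) \<cdot>\<^bsub>M\<^esub> AMap P u"
    have \<mu>: "arrow w \<mu> ?p" unfolding \<mu>_def by (rule arrowI[OF u(1,2) yq d(2)])
    have G\<mu>: "AMap G \<mu> = \<gamma>"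
      using G.map_comp[OF Pu P.map_hom[OF d(2)]] GP_hom[OF d(2)] GP_hom[OF u(1)] d(3) u(2)
        F.cod.hom_ident(1)[OF \<gamma>h] by (simp add: \<mu>_def)
    have c\<mu>: "AMap P (cF \<alpha> x) \<cdot>\<^bsub>M\<^esub> \<mu> = \<nu>"
      using G.dom.comp_assoc[OF Pu P.map_hom[OF d(2)] PC] P.map_comp[OF d(2) c(2)] Pk u(4)
      by (simp add: \<mu>_def)
    show "\<exists>!s. s \<in> hom bar W (cls ?p) \<and> AMap barF s = \<gamma> \<and> AMap Q (cF \<alpha> x) \<cdot>\<^bsub>bar\<^esub> s = t"
    proof (intro ex1I[of _ "(cls w, \<mu>, cls ?p)"] conjI)
      show "(cls w, \<mu>, cls ?p) \<in> hom bar W (cls ?p)" using \<mu> bar_hom_cls_iff w c(4) by blast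
      show "AMap barF (cls w, \<mu>, cls ?p) = \<gamma>" using G\<mu> by (simp add: bar_proj_def)
      show "AMap Q (cF \<alpha> x) \<cdot>\<^bsub>bar\<^esub> (cls w, \<mu>, cls ?p) = t"
        using AMap_Q[OF c(2)] bar_comp c\<mu> t' by simp
    next
      fix s assume s: "s \<in> hom bar W (cls ?p) \<and> AMap barF s = \<gamma> \<and> AMap Q (cF \<alpha> x) \<cdot>\<^bsub>bar\<^esub> s = t"
      then obtain \<mu>' where s': "s = (cls w, \<mu>', cls ?p)" "arrow w \<mu>' ?p"
        using bar_hom_cls_iff[OF w(1) c(4)] w(2) by auto
      have "AMap G \<mu>' = \<gamma>" "AMap P (cF \<alpha> x) \<cdot>\<^bsub>M\<^esub> \<mu>' = \<nu>"
        using s s'(1) t' AMap_Q[OF c(2)] bar_comp by (auto simp: bar_proj_def)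
      then have "\<mu>' = \<mu>" using ex1 arrow_hom[OF s'(2)] arrow_hom[OF \<mu>] G\<mu> c\<mu> by blast
      then show "s = (cls w, \<mu>, cls ?p)" using s' by simp
    qed
  qed
qed

lemma cleavage_cF: "cleavage X A F cF"
  using choices by (simp add: construction_choices_def)

lemma barF_cleavage: "cleavage bar A barF (\<lambda>\<alpha> U. AMap Q (cF \<alpha> (SOME x. x \<in> U)))"
  unfolding cleavage_def
proof (intro ballI impI)
  fix U \<alpha> assume U: "U \<in> Obj bar" and \<alpha>: "\<alpha> \<in> Arr A" "Cod A \<alpha> = OMap barF U"
  obtain x0 where x0: "x0 \<in> Obj X" "U = cls x0" using U by (rule bar_objE)
  define x where "x = (SOME x. x \<in> U)"
  have "x \<in> U" unfolding x_def using cls_self x0 by (metis someI)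
  then have rel: "x0 \<approx> x" using x0 mem_cls_iff by simp
  then have x: "x \<in> Obj X" "U = cls x" using related_obj x0 cls_eq_iff by auto
  have \<alpha>': "\<alpha> \<in> hom A (Dom A \<alpha>) (OMap F x)"
    using \<alpha> x the_elem_cls by (simp add: hom_def bar_proj_def)
  note c = pull[OF x(1) \<alpha>']
  have "Cod bar (AMap Q (cF \<alpha> x)) = U"
    using AMap_Q[OF c(2)] x(2) by (simp add: bar_cat_def)
  moreover have "AMap barF (AMap Q (cF \<alpha> x)) = \<alpha>"
    using AMap_Q[OF c(2)] c(3) GP_hom[OF c(2)] by (simp add: bar_proj_def)
  ultimately show "cartesian bar A barF (AMap Q (cF \<alpha> (SOME x. x \<in> U))) \<and>
    Cod bar (AMap Q (cF \<alpha> (SOME x. x \<in> U))) = U \<and> AMap barF (AMap Q (cF \<alpha> (SOME x. x \<in> U))) = \<alpha>"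
    using Q_pull_cartesian[OF x(1) \<alpha>'] unfolding x_def by blast
qed

lemma barF_fibration: "fibration bar A barF"
  using barF_functor barF_cleavage by (auto simp: fibration_def)

lemma Q_1cell: "fib_1cell A (X, F) (bar, barF) Q"
proof -
  have "cartesian bar A barF (AMap Q (cF \<alpha> x))" if "x \<in> Obj X" "\<alpha> \<in> Arr A" "Cod A \<alpha> = OMap F x" for \<alpha> x
    using Q_pull_cartesian[of x \<alpha> "Dom A \<alpha>"] that by (simp add: hom_def)
  then have "cartesian bar A barF (AMap Q f)" if "cartesian X A F f" for f
    using preserves_cartesian_if_on_cleavage[OF F.is_functor_axioms barF_functor Q_functor barF_Q
      cleavage_cF _ that] by blast
  moreover have "fibration X A F" using F.is_functor_axioms cleavage_cF by (auto simp: fibration_def)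
  ultimately show ?thesis using barF_fibration Q_functor barF_Q by simp
qed

section \<open>Extension along the quotient functor\<close>

text \<open>The generation property on which existence of fillers depends: the arrows of \<open>X\<close> need not
  compose to give \<open>t\<close>, but any functor on \<open>X\<close> that is constant on classes makes them composable.\<close>

lemma bar_arrow_factors_through_Q:
  assumes t: "t \<in> hom bar (cls x1) (cls x2)" and x1: "x1 \<in> Obj X" and x2: "x2 \<in> Obj X"
  obtains u y f y' where "u \<in> hom X x1 y" "f \<in> hom X y' x2" "cls y = cls y'"
    "t = AMap Q f \<cdot>\<^bsub>bar\<^esub> AMap Q u"
proof -
  obtain \<mu> where \<mu>: "t = (cls x1, \<mu>, cls x2)" "arrow x1 \<mu> x2" using bar_hom_cls_iff[OF x1 x2] t by blast
  obtain u y where u: "u \<in> hom X x1 y" "y \<approx> pull (AMap G \<mu>) x2"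
    "AMap P (cF (AMap G \<mu>) x2) \<cdot>\<^bsub>M\<^esub> AMap P u = \<mu>" "AMap G \<mu> \<in> hom A (OMap F x1) (OMap F x2)"
    using arrowE[OF \<mu>(2) x1 x2] by metis
  have f: "cF (AMap G \<mu>) x2 \<in> hom X (pull (AMap G \<mu>) x2) x2" using pull(2)[OF x2 u(4)] .
  have "t = AMap Q (cF (AMap G \<mu>) x2) \<cdot>\<^bsub>bar\<^esub> AMap Q u"
    using \<mu> u AMap_Q[OF u(1)] AMap_Q[OF f] bar_comp by simp
  then show thesis using that u(1) f cls_eq_iff related_obj[OF u(2)] u(2) by blast
qed

text \<open>The filler is defined on arrows by its image under \<open>g\<close>. As \<open>g\<close> is faithful, every equation
  between arrows of \<open>C\<close> is checked in \<open>D\<close>, where it becomes an equation about \<open>k\<close>.\<close>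

lemma Q_orthogonal_to_discrete_opfibration:
  assumes g: "discrete_opfibration A (C, K) (D, L) g"
    and h: "fib_1cell A (X, F) (C, K) h" and k: "fib_1cell A (bar, barF) (D, L) k"
    and sq: "func_eq X (g \<odot> h) (k \<odot> Q)"
  shows "\<exists>d. fib_1cell A (bar, barF) (C, K) d \<and> func_eq X (d \<odot> Q) h \<and> func_eq bar (g \<odot> d) k \<and>
    (\<forall>d'. fib_1cell A (bar, barF) (C, K) d' \<and> func_eq X (d' \<odot> Q) h \<and> func_eq bar (g \<odot> d') k
      \<longrightarrow> func_eq bar d' d)"
proof -
  from g have gcell: "fib_1cell A (C, K) (D, L) g" by (simp add: discrete_opfibration_def)
  interpret g: is_functor C D g using gcell by simp
  interpret K: is_functor C A K using gcell by (simp add: fibration_def)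
  interpret L: is_functor D A L using gcell by (simp add: fibration_def)
  interpret h: is_functor X C h using h by simp
  interpret k: is_functor bar D k using k by simp
  interpret barF: is_functor bar A barF by (rule barF_functor)
  interpret Q: is_functor X bar Q by (rule Q_functor)
  have gh_obj: "OMap g (OMap h x) = OMap k (cls x)" if "x \<in> Obj X" for x
    using sq that by (simp add: func_eq_def func_comp_def bar_Q_def)
  have gh_arr: "AMap g (AMap h f) = AMap k (AMap Q f)" if "f \<in> hom X x y" for f x y
    using sq that by (simp add: func_eq_def func_comp_def hom_def)
  have Q_hom: "AMap Q f \<in> hom bar (cls x) (cls y)" if "f \<in> hom X x y" for f x y
    using Q.map_hom[OF that] by (simp add: bar_Q_def)
  note faithful = discrete_opfibration_faithful[OF g]
  have h_related: "OMap h x = OMap h y" if "x \<approx> y" for x y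
    using that
  proof (induction rule: related_induct)
    case (step x y v)
    have x: "x \<in> Obj X" and y: "y \<in> Obj X" using related_obj step(4) by auto
    \<comment> \<open>\<open>Q\<close> sends \<open>v\<close> to an identity, so \<open>g\<close> sends \<open>h v\<close> to one.\<close>
    have "cls y = cls x" using cls_eq_iff[OF y x] related_sym step(4) by blast
    then have "AMap Q v = Ident bar (cls x)" using AMap_Q[OF step(1)] bar_ident[OF x] step(3) by simp
    then have "AMap g (AMap h v) = Ident D (OMap g (OMap h x))"
      using gh_arr[OF step(1)] k.map_ident[OF cls_obj[OF x]] gh_obj[OF x] by simp
    then show ?case
      using discrete_opfibration_reflects_identities[OF g h.map_hom[OF step(1)]] by simp
  qed auto
  define rep where "rep U = (SOME x. x \<in> U)" for U :: "'xo set"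
  have h_rep: "OMap h (rep (cls x)) = OMap h x" if "x \<in> Obj X" for x
  proof -
    have "rep (cls x) \<in> cls x" unfolding rep_def using cls_self[OF that] by (rule someI)
    then have "x \<approx> rep (cls x)" by (simp add: mem_cls_iff)
    then show ?thesis by (rule h_related[symmetric])
  qed
  have lift: "\<exists>u\<in>hom C (OMap h x1) (OMap h x2). AMap g u = AMap k t"
    if x1: "x1 \<in> Obj X" and x2: "x2 \<in> Obj X" and t: "t \<in> hom bar (cls x1) (cls x2)" for x1 x2 t
  proof -
    obtain u y f y' where uf: "u \<in> hom X x1 y" "f \<in> hom X y' x2" "cls y = cls y'"
      "t = AMap Q f \<cdot>\<^bsub>bar\<^esub> AMap Q u"
      using bar_arrow_factors_through_Q[OF t x1 x2] by metis
    have "y \<approx> y'" using uf(3) cls_eq_iff hom_objs[OF uf(1)] hom_objs[OF uf(2)] by blast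
    then have "OMap h y = OMap h y'" by (rule h_related)
    then have hu: "AMap h u \<in> hom C (OMap h x1) (OMap h y')" using h.map_hom[OF uf(1)] by simp
    have Qu: "AMap Q u \<in> hom bar (cls x1) (cls y')" using Q_hom[OF uf(1)] uf(3) by simp
    have "AMap g (AMap h f \<cdot>\<^bsub>C\<^esub> AMap h u) = AMap k t"
      using g.map_comp[OF hu h.map_hom[OF uf(2)]] gh_arr[OF uf(1)] gh_arr[OF uf(2)]
        k.map_comp[OF Qu Q_hom[OF uf(2)]] uf(4) by simp
    then show ?thesis using g.dom.comp_hom[OF hu h.map_hom[OF uf(2)]] by blast
  qed
  \<comment> \<open>By \<open>lift\<close> and faithfulness of \<open>g\<close> the description picks out exactly one arrow.\<close>
  define d :: "('xo set, 'xo set \<times> 'ma \<times> 'xo set, _, _) func" where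
    "d = \<lparr>OMap = (\<lambda>U. OMap h (rep U)),
          AMap = (\<lambda>t. THE u. u \<in> hom C (OMap h (rep (Dom bar t))) (OMap h (rep (Cod bar t))) \<and>
                   AMap g u = AMap k t)\<rparr>"
  have d_cls: "OMap d (cls x) = OMap h x" if "x \<in> Obj X" for x
    using h_rep[OF that] by (simp add: d_def)
  have d_arr: "AMap d t \<in> hom C (OMap d U) (OMap d V) \<and> AMap g (AMap d t) = AMap k t"
    if t: "t \<in> hom bar U V" for t U V
  proof -
    obtain x1 x2 where x: "x1 \<in> Obj X" "x2 \<in> Obj X" "U = cls x1" "V = cls x2"
      using t by (rule bar_homE)
    let ?S = "\<lambda>u. u \<in> hom C (OMap d U) (OMap d V) \<and> AMap g u = AMap k t"
    have "t \<in> hom bar (cls x1) (cls x2)" using t x by simp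
    then have "\<exists>u. ?S u" using lift[OF x(1,2)] x d_cls by fastforce
    then have "\<exists>!u. ?S u" using faithful by metis
    then have "?S (THE u. ?S u)" by (rule theI')
    moreover have "AMap d t = (THE u. ?S u)" using t by (simp add: d_def hom_def)
    ultimately show ?thesis by simp
  qed
  have gd_obj: "OMap g (OMap d U) = OMap k U" if "U \<in> Obj bar" for U
    using that d_cls gh_obj by (metis bar_objE)
  have d_functor: "is_functor bar C d"
  proof (intro is_functor.intro is_functor_axioms.intro)
    show "category bar" by (rule bar_category)
    show "category C" by (rule g.dom.category_axioms)
  next
    fix U assume U: "U \<in> Obj bar"
    show dU: "OMap d U \<in> Obj C" using U d_cls h.map_obj by (metis bar_objE)
    have i: "Ident bar U \<in> hom bar U U" using k.dom.ident_hom[OF U] .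
    show "AMap d (Ident bar U) = Ident C (OMap d U)"
      using faithful[OF _ g.dom.ident_hom[OF dU]] d_arr[OF i] k.map_ident[OF U] g.map_ident[OF dU] gd_obj[OF U]
      by simp
  next
    show "AMap d t \<in> hom C (OMap d U) (OMap d V)" if "t \<in> hom bar U V" for t U V
      using d_arr[OF that] by blast
  next
    fix s t U V W assume s: "s \<in> hom bar U V" and t: "t \<in> hom bar V W"
    have ds: "AMap d s \<in> hom C (OMap d U) (OMap d V)" and dt: "AMap d t \<in> hom C (OMap d V) (OMap d W)"
      using d_arr[OF s] d_arr[OF t] by auto
    have "AMap g (AMap d (t \<cdot>\<^bsub>bar\<^esub> s)) = AMap g (AMap d t \<cdot>\<^bsub>C\<^esub> AMap d s)"
      using d_arr[OF k.dom.comp_hom[OF s t]] d_arr[OF s] d_arr[OF t] g.map_comp[OF ds dt]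
        k.map_comp[OF s t] by simp
    then show "AMap d (t \<cdot>\<^bsub>bar\<^esub> s) = AMap d t \<cdot>\<^bsub>C\<^esub> AMap d s"
      using faithful[OF _ g.dom.comp_hom[OF ds dt]] d_arr[OF k.dom.comp_hom[OF s t]] by blast
  qed
  have gd: "func_eq bar (g \<odot> d) k"
    using gd_obj d_arr[OF bar_arr_hom] by (auto simp: func_eq_def func_comp_def)
  have dQ_arr: "AMap d (AMap Q f) = AMap h f" if f: "f \<in> hom X x y" for f x y
  proof -
    have "AMap d (AMap Q f) \<in> hom C (OMap h x) (OMap h y)"
      using d_arr[OF Q_hom[OF f]] d_cls hom_objs[OF f] by simp
    then show ?thesis using faithful[OF _ h.map_hom[OF f]] d_arr[OF Q_hom[OF f]] gh_arr[OF f] by simp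
  qed
  have dQ: "func_eq X (d \<odot> Q) h"
    using d_cls dQ_arr by (auto simp: func_eq_def func_comp_def bar_Q_def hom_def)
  have LgK_obj: "OMap L (OMap g c) = OMap K c" if "c \<in> Obj C" for c
    using gcell that by (simp add: func_eq_def func_comp_def)
  have LgK_arr: "AMap L (AMap g u) = AMap K u" if "u \<in> hom C c c'" for u c c'
    using gcell that by (simp add: func_eq_def func_comp_def hom_def)
  have Kd: "func_eq bar (K \<odot> d) barF"
    unfolding func_eq_def
  proof (intro conjI ballI)
    fix U assume U: "U \<in> Obj bar"
    have "OMap L (OMap k U) = OMap barF U" using k U by (simp add: func_eq_def func_comp_def)
    then show "OMap (K \<odot> d) U = OMap barF U"
      using LgK_obj[OF is_functor.map_obj[OF d_functor U]] gd_obj[OF U] by (simp add: func_comp_def)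
  next
    fix t assume t: "t \<in> Arr bar"
    have "AMap L (AMap k t) = AMap barF t" using k t by (simp add: func_eq_def func_comp_def)
    moreover have "AMap L (AMap g (AMap d t)) = AMap K (AMap d t)"
      using LgK_arr d_arr[OF bar_arr_hom[OF t]] by blast
    ultimately show "AMap (K \<odot> d) t = AMap barF t"
      using d_arr[OF bar_arr_hom[OF t]] by (simp add: func_comp_def)
  qed
  have d_cart: "cartesian C A K (AMap d t)" if t: "cartesian bar A barF t" for t
  proof (rule preserves_cartesian_if_on_cleavage[OF barF_functor K.is_functor_axioms d_functor Kd
        barF_cleavage _ t])
    fix \<alpha> U assume U: "U \<in> Obj bar" and \<alpha>: "\<alpha> \<in> Arr A" "Cod A \<alpha> = OMap barF U"
    obtain x0 where x0: "x0 \<in> Obj X" "U = cls x0" using U by (rule bar_objE)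
    have "rep U \<in> cls x0" unfolding rep_def x0(2) using cls_self[OF x0(1)] by (rule someI)
    then have x0r: "x0 \<approx> rep U" by (simp add: mem_cls_iff)
    then have r: "rep U \<in> Obj X" using related_obj by blast
    have \<alpha>': "\<alpha> \<in> hom A (Dom A \<alpha>) (OMap F (rep U))"
      using \<alpha> x0 the_elem_cls related_F[OF x0r] by (simp add: hom_def bar_proj_def)
    note c = pull[OF r \<alpha>']
    have "cartesian C A K (AMap h (cF \<alpha> (rep U)))" using h c(1) by simp
    then show "cartesian C A K (AMap d (AMap Q (cF \<alpha> (SOME x. x \<in> U))))"
      using dQ_arr[OF c(2)] by (simp add: rep_def)
  qed
  have dcell: "fib_1cell A (bar, barF) (C, K) d"
    using barF_fibration gcell d_functor Kd d_cart by simp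
  have "func_eq bar d' d"
    if d': "fib_1cell A (bar, barF) (C, K) d'" "func_eq X (d' \<odot> Q) h" "func_eq bar (g \<odot> d') k" for d'
  proof -
    interpret d': is_functor bar C d' using d'(1) by simp
    have o: "OMap d' U = OMap d U" if U: "U \<in> Obj bar" for U
    proof -
      obtain x where x: "x \<in> Obj X" "U = cls x" using U by (rule bar_objE)
      have "OMap d' (cls x) = OMap h x"
        using d'(2) x(1) by (simp add: func_eq_def func_comp_def bar_Q_def)
      then show ?thesis using d_cls x by simp
    qed
    have "AMap d' t = AMap d t" if t: "t \<in> Arr bar" for t
    proof (rule faithful)
      show "AMap d t \<in> hom C (OMap d (Dom bar t)) (OMap d (Cod bar t))"
        using d_arr[OF bar_arr_hom[OF t]] by blast
      show "AMap d' t \<in> hom C (OMap d (Dom bar t)) (OMap d (Cod bar t))"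
        using d'.map_hom[OF bar_arr_hom[OF t]] o k.dom.dom_obj[OF t] k.dom.cod_obj[OF t] by simp
      show "AMap g (AMap d' t) = AMap g (AMap d t)"
        using d_arr[OF bar_arr_hom[OF t]] d'(3) t by (simp add: func_eq_def func_comp_def)
    qed
    with o show ?thesis by (simp add: func_eq_def)
  qed
  then show ?thesis using dcell dQ gd by blast
qed

end

theorem theorem3p10:
  fixes A :: "('p, 'b) cat"
    and X :: "('xo, 'xa) cat" and F :: "('xo, 'xa, 'p, 'b) func"
    and M :: "('mo, 'ma) cat" and G :: "('mo, 'ma, 'p, 'b) func"
    and P :: "('xo, 'xa, 'mo, 'ma) func"
    and cG :: "'b \<Rightarrow> 'mo \<Rightarrow> 'ma" and cF :: "'b \<Rightarrow> 'xo \<Rightarrow> 'xa" and cP :: "'ma \<Rightarrow> 'xo \<Rightarrow> 'xa"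
  assumes "fib_1cell A (X, F) (M, G) P"
    and "fiberwise_opfibration A X F M G P"
    and "split_fibration M A G"
    and "construction_choices A X F M G P cG cF cP"
  shows "initial_1cell A (X, F) (bar_cat A X F M G P cF cP, bar_proj F G) (bar_Q X M P)
           TYPE('co \<times> 'ca) TYPE('do \<times> 'da)"
proof -
  interpret F: is_functor X A F using assms(1) by (simp add: fibration_def)
  interpret G: is_functor M A G using assms(1) by (simp add: fibration_def)
  interpret P: is_functor X M P using assms(1) by simp
  interpret fiberwise_construction A X F M G P cG cF cP
    by unfold_locales (use assms(1,4) in \<open>auto simp: func_eq_def func_comp_def\<close>)
  show ?thesis
    unfolding initial_1cell_def fst_conv
  proof (intro conjI allI impI)
    show "fib_1cell A (X, F) (bar, barF) Q" by (rule Q_1cell)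
  next
    fix C :: "('co, 'ca, 'p, 'b) over" and D :: "('do, 'da, 'p, 'b) over" and g h k
    assume "discrete_opfibration A C D g \<and> fib_1cell A (X, F) C h \<and>
      fib_1cell A (bar, barF) D k \<and> func_eq X (g \<odot> h) (k \<odot> Q)"
    then show "\<exists>d. fib_1cell A (bar, barF) C d \<and> func_eq X (d \<odot> Q) h \<and> func_eq bar (g \<odot> d) k \<and>
        (\<forall>d'. fib_1cell A (bar, barF) C d' \<and> func_eq X (d' \<odot> Q) h \<and> func_eq bar (g \<odot> d') k
          \<longrightarrow> func_eq bar d' d)"
      using Q_orthogonal_to_discrete_opfibration[of "fst C" "snd C" "fst D" "snd D" g h k] by simp
  qed
qed

end
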